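(* Suppose $\theta_1,\theta_2$ are two objects located in $(0,1]$ ($k=2$), with the prior $f_0$ uniform over $(0,1]$, and let $A_1=\left(\frac12,1\right]$ and $A_2=\left(\frac14,\frac12\right]\cup\left(\frac34,1\right]$ be the first two questions of the dyadic policy. Consider the following family of third questions, indexed by $0\le\alpha,\beta\le1$: $$A_3=\left(\tfrac{1-\alpha}{4},\tfrac14\right]\cup\left(\tfrac{2-\beta}{4},\tfrac12\right]\cup\left(\tfrac{3-\beta}{4},\tfrac34\right]\cup\left(\tfrac{4-\alpha}{4},1\right].$$ (i) If $X_1=0$ and $X_2=2$, then the conditional probability mass function of $X_3$ is $P(X_3=x)=f_{\mathrm{PB}}(x;q_1=\beta,q_2=\beta)$, a Binomial distribution with (two trials and) parameter $\beta$. Its entropy is maximal when $\beta=0.5$. The dyadic question, which corresponds to $\alpha=\beta=0.5$, satisfies this condition and is consequently also a valid question for the greedy policy. (ii) If $X_1=X_2=1$, then the conditional probability mass function of $X_3$ is $$p_2(X_3=x)=\tfrac14 f_{\mathrm{PB}}(x;\alpha,\alpha)+\tfrac14 f_{\mathrm{PB}}(x;\beta,\beta)+\tfrac14 f_{\mathrm{PB}}(x;\beta,\beta)+\tfrac14 f_{\mathrm{PB}}(x;\alpha,\alpha),$$ that is, $$p_2(X_3=0)=\tfrac12(1-\alpha)^2+\tfrac12(1-\beta)^2,\quad p_2(X_3=1)=\alpha(1-\alpha)+\beta(1-\beta),\quad p_2(X_3=2)=\tfrac12\alpha^2+\tfrac12\beta^2.$$ With $$\alpha=\frac{1+\frac{\sqrt3}{3}}{2}\quad\text{and}\quad\beta=\frac{1-\frac{\sqrt3}{3}}{2}$$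 one has $p_2(X_3=x)=\frac13$ for $x=0,1,2$. In this case $H(p_2(X_3=\cdot))=\log(3)>1.5$, which shows that the greedy policy is in this case strictly better than the dyadic policy.
   Context: $\log$ is the logarithm to base 2. $\theta=(\theta_1,\dots,\theta_k)$ is a random vector whose coordinates are i.i.d. with Lebesgue density $f_0$ on $\mathbb R$ (the prior). One asks questions $A_1,A_2,\dots\subset\mathbb R$ sequentially, and the answer to $A_n$ is $X_n=\sum_{i=1}^k\mathbb 1_{A_n}(\theta_i)$. A policy is a rule for choosing the questions; $A_n$ may depend on the previous answers $X_1,\dots,X_{n-1}$ and on an independent random seed. $p_n$ denotes the posterior distribution of $\theta$ after $n$ questions and answers (with density proportional to the prior density on the set of $u\in\mathbb R^k$ with $\sum_{i=1}^k\mathbb 1_{A_m}(u_i)=X_m$ for $1\le m\le n$, and $0$ outside), and $p_2(X_3=x)$ denotes the conditional probability that $X_3=x$ given the first two questions and answers, when the third question is $A_3$. $H$ denotes entropy (differential entropy for the posterior densities $p_n$, discrete entropy for the distribution of an answer). The quality of a policy is measured by how much it reduces the expected entropy $E[H(p_N)]$ of the posterior. For a given history and a given next question, the expected one-step reduction of the entropy of the posterior equals the conditional entropy of the next answer given the history. $f_{\mathrm{PB}}(\cdot\,;q_1,\dots,q_m)$ is the probability mass function of the Poisson Binomial distribution, i.e. of $W_1+\dots+W_m$ with $W_i\sim\mathrm{Bernoulli}(q_i)$ independent. Greedy policy: any policy with $A_n\in\arg\min_A E[H(p_n)\mid p_{n-1},A_n=A]$ for all $n$, the argmin being over all Borel subsets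 $A$ of $\mathbb R$; equivalently, $A_n$ maximizes the conditional entropy of $X_n$ given the history. Dyadic policy (for $f_0$ uniform on $(0,1]$): the policy asking, deterministically, $A_n=\bigcup_{j=1}^{2^{n-1}}\left(\frac{2j-1}{2^n},\frac{2j}{2^n}\right]$, $n\ge1$. Under it, for $k=2$, the conditional distribution of each answer given the history is $\mathrm{Bin}(2,\frac12)$, whose entropy is $1.5$. *)

theory Defs
  imports "HOL-Probability.Probability"
begin

text \<open>
  The object locations are real random variables \<open>\<theta> 0, \<dots>, \<theta> (k - 1)\<close> on a probability space \<open>M\<close>.
  A history is the list of the questions asked so far, each paired with its answer.
\<close>

type_synonym history = "(real set \<times> nat) list"

definition answer :: "nat \<Rightarrow> (nat \<Rightarrow> 'w \<Rightarrow> real) \<Rightarrow> real set \<Rightarrow> 'w \<Rightarrow> nat" where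
  "answer k \<theta> A \<omega> = (\<Sum>i<k. indicator A (\<theta> i \<omega>))"

definition given ::
    "'w measure \<Rightarrow> nat \<Rightarrow> (nat \<Rightarrow> 'w \<Rightarrow> real) \<Rightarrow> history \<Rightarrow> 'w measure" where
  "given M k \<theta> h =
     uniform_measure M {\<omega> \<in> space M. \<forall>(A, x) \<in> set h. answer k \<theta> A \<omega> = x}"

definition answer_prob ::
    "'w measure \<Rightarrow> nat \<Rightarrow> (nat \<Rightarrow> 'w \<Rightarrow> real) \<Rightarrow> history \<Rightarrow> real set \<Rightarrow> nat \<Rightarrow> real" where
  "answer_prob M k \<theta> h A x = \<P>(\<omega> in given M k \<theta> h. answer k \<theta> A \<omega> = x)"

definition answer_entropy ::
    "'w measure \<Rightarrow> nat \<Rightarrow> (nat \<Rightarrow> 'w \<Rightarrow> real) \<Rightarrow> history \<Rightarrow> real set \<Rightarrow> real" where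
  "answer_entropy M k \<theta> h A =
     prob_space.entropy (given M k \<theta> h) 2 (count_space UNIV) (answer k \<theta> A)"

text \<open>
  Differential entropy of the posterior, which is the law of the vector \<open>\<theta>\<close> under \<open>given M k \<theta> h\<close>;
  if \<open>\<theta>\<close> has a Lebesgue density, the posterior has the normalised restriction of that density
  to the vectors consistent with \<open>h\<close>. Only meaningful for histories of positive probability.
\<close>

definition posterior_entropy ::
    "'w measure \<Rightarrow> nat \<Rightarrow> (nat \<Rightarrow> 'w \<Rightarrow> real) \<Rightarrow> history \<Rightarrow> real" where
  "posterior_entropy M k \<theta> h =
     prob_space.entropy (given M k \<theta> h) 2 (PiM {..<k} (\<lambda>_. lborel)) (\<lambda>\<omega>. \<lambda>i\<in>{..<k}. \<theta> i \<omega>)"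

text \<open>\<open>E[H(p\<^sub>n) | p\<^sub>n\<^sub>-\<^sub>1, A\<^sub>n = A]\<close>, where \<open>p\<^sub>n\<^sub>-\<^sub>1\<close> is the posterior after the history \<open>h\<close>.\<close>

definition next_entropy ::
    "'w measure \<Rightarrow> nat \<Rightarrow> (nat \<Rightarrow> 'w \<Rightarrow> real) \<Rightarrow> history \<Rightarrow> real set \<Rightarrow> real" where
  "next_entropy M k \<theta> h A =
     (\<integral>\<omega>. posterior_entropy M k \<theta> (h @ [(A, answer k \<theta> A \<omega>)]) \<partial>given M k \<theta> h)"

definition greedy_questions ::
    "'w measure \<Rightarrow> nat \<Rightarrow> (nat \<Rightarrow> 'w \<Rightarrow> real) \<Rightarrow> history \<Rightarrow> real set set" where
  "greedy_questions M k \<theta> h =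
     {A. is_arg_min (next_entropy M k \<theta> h) (\<lambda>A. A \<in> sets borel) A}"

text \<open>
  A policy maps the seed and the list of previous answers (oldest first) to the next question.
  The seed has law \<open>S\<close> and is independent of \<open>\<theta>\<close>, so it is integrated separately below.
\<close>

type_synonym 's policy = "'s \<Rightarrow> nat list \<Rightarrow> real set"

definition is_policy :: "'s measure \<Rightarrow> 's policy \<Rightarrow> bool" where
  "is_policy S \<pi> \<longleftrightarrow> prob_space S \<and>
     (\<forall>xs. {(s, y). s \<in> space S \<and> y \<in> \<pi> s xs} \<in> sets (S \<Otimes>\<^sub>M borel))"

definition history_of :: "(nat list \<Rightarrow> real set) \<Rightarrow> nat list \<Rightarrow> history" where
  "history_of p xs = map (\<lambda>j. (p (take j xs), xs ! j)) [0..<length xs]"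

fun answers ::
    "nat \<Rightarrow> (nat \<Rightarrow> 'w \<Rightarrow> real) \<Rightarrow> (nat list \<Rightarrow> real set) \<Rightarrow> nat \<Rightarrow> 'w \<Rightarrow> nat list" where
  "answers k \<theta> p 0 \<omega> = []"
| "answers k \<theta> p (Suc n) \<omega> =
     answers k \<theta> p n \<omega> @ [answer k \<theta> (p (answers k \<theta> p n \<omega>)) \<omega>]"

text \<open>\<open>E[H(p\<^sub>N)]\<close> under the policy \<open>\<pi>\<close>.\<close>

definition expected_entropy ::
    "'w measure \<Rightarrow> nat \<Rightarrow> (nat \<Rightarrow> 'w \<Rightarrow> real) \<Rightarrow> 's measure \<Rightarrow> 's policy \<Rightarrow> nat \<Rightarrow> real" where
  "expected_entropy M k \<theta> S \<pi> N =
     (\<integral>s. (\<integral>\<omega>. posterior_entropy M k \<theta> (history_of (\<pi> s) (answers k \<theta> (\<pi> s) N \<omega>)) \<partial>M) \<partial>S)"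

text \<open>
  The argmin condition is imposed only after histories of positive probability, since the
  posterior is undefined after the others.
\<close>

definition greedy_policy ::
    "'w measure \<Rightarrow> nat \<Rightarrow> (nat \<Rightarrow> 'w \<Rightarrow> real) \<Rightarrow> 's measure \<Rightarrow> 's policy \<Rightarrow> bool" where
  "greedy_policy M k \<theta> S \<pi> \<longleftrightarrow> is_policy S \<pi> \<and>
     (\<forall>s\<in>space S. \<forall>xs. 0 < \<P>(\<omega> in M. answers k \<theta> (\<pi> s) (length xs) \<omega> = xs) \<longrightarrow>
        \<pi> s xs \<in> greedy_questions M k \<theta> (history_of (\<pi> s) xs))"

definition dyadic_question :: "nat \<Rightarrow> real set" where
  "dyadic_question n = (\<Union>j\<in>{1..2 ^ (n - 1)}. {(2 * real j - 1) / 2 ^ n <.. 2 * real j / 2 ^ n})"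

definition dyadic_policy :: "'s policy" where
  "dyadic_policy s xs = dyadic_question (length xs + 1)"

definition poisson_binomial_pmf :: "real list \<Rightarrow> nat pmf" where
  "poisson_binomial_pmf qs =
     map_pmf (\<lambda>W. \<Sum>i<length qs. of_bool (W i))
       (Pi_pmf {..<length qs} False (\<lambda>i. bernoulli_pmf (qs ! i)))"

end

(* After a history h of positive probability the posterior is uniform on the set of
   location vectors consistent with h, so its entropy is log P(h), and therefore the expected
   entropy after asking A is log P(h) - H(answer | h): greedy questions are those maximising
   the conditional entropy of the answer.

   After (X1, X2) = (0, 2) both objects are uniform on (1/4, 1/2], so every answer is Bin(2, q), with
   entropy 2 h(q) - 2 q (1 - q) for the binary entropy h; this is at most 3/2 by a Pinsker-type
   bound on h. After (1, 1) the objects lie in the quarters {1, 4} or {2, 3}, in either order, the four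
   cases being equally likely; the entropy log 3 of a uniform answer is trivially maximal.

   For the comparison of E[H(p_3)]: greedy questions minimise next_entropy, so the expected entropy
   given the seed does not depend on which minimisers the seed selects. It is a constant function of
   the seed, hence integrable without any measurability argument. *)
theory Submission
  imports Defs
begin

section \<open>Random variables of finite range\<close>

text \<open>On the sample space \<open>F (Y \<omega>)\<close> is a finite combination of indicators
  of the level sets of \<open>Y\<close>. Measurability is asked of the level sets, so that
  \<open>Y\<close> may take values in lists or pairs, and \<open>F\<close> may be arbitrary, in
  particular a posterior entropy at a history of probability zero.\<close>

lemma (in prob_space) expectation_finite_range:
  fixes F :: "'b \<Rightarrow> real"
  assumes S: "finite S" "\<And>\<omega>. \<omega> \<in> space M \<Longrightarrow> Y \<omega> \<in> S"
    and meas: "\<And>y. y \<in> S \<Longrightarrow> {\<omega> \<in> space M. Y \<omega> = y} \<in> events"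
  shows "expectation (\<lambda>\<omega>. F (Y \<omega>)) = (\<Sum>y\<in>S. \<P>(\<omega> in M. Y \<omega> = y) * F y)"
proof -
  have "expectation (\<lambda>\<omega>. F (Y \<omega>)) =
      expectation (\<lambda>\<omega>. \<Sum>y\<in>S. indicator {\<omega> \<in> space M. Y \<omega> = y} \<omega> * F y)"
  proof (rule Bochner_Integration.integral_cong)
    fix \<omega> assume "\<omega> \<in> space M"
    then have "(\<Sum>y\<in>S. indicator {\<omega> \<in> space M. Y \<omega> = y} \<omega> * F y) = (\<Sum>y\<in>S. if Y \<omega> = y then F y else 0)"
      by (intro sum.cong) auto
    then show "F (Y \<omega>) = (\<Sum>y\<in>S. indicator {\<omega> \<in> space M. Y \<omega> = y} \<omega> * F y)"
      using S(1) S(2)[OF \<open>\<omega> \<in> space M\<close>] by simp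
  qed simp
  also have "\<dots> = (\<Sum>y\<in>S. \<P>(\<omega> in M. Y \<omega> = y) * F y)"
  proof (subst Bochner_Integration.integral_sum)
    fix y assume "y \<in> S"
    then show "integrable M (\<lambda>\<omega>. indicator {\<omega> \<in> space M. Y \<omega> = y} \<omega> * F y)"
      using meas by (intro integrable_mult_left integrable_real_indicator) (auto simp: emeasure_eq_measure)
  next
    show "(\<Sum>y\<in>S. expectation (\<lambda>\<omega>. indicator {\<omega> \<in> space M. Y \<omega> = y} \<omega> * F y)) =
        (\<Sum>y\<in>S. \<P>(\<omega> in M. Y \<omega> = y) * F y)"
      by (intro sum.cong) (auto simp: Int_def intro!: arg_cong[where f=prob])
  qed
  finally show ?thesis .
qed

text \<open>The point probabilities are a density of \<open>Y\<close> with respect to counting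
  measure, and they vanish outside \<open>S\<close>; the entropy integral is therefore a finite
  sum.\<close>

lemma (in information_space) entropy_finite_range:
  assumes Y: "Y \<in> M \<rightarrow>\<^sub>M count_space UNIV" and S: "finite S" "\<And>\<omega>. \<omega> \<in> space M \<Longrightarrow> Y \<omega> \<in> S"
  shows "entropy b (count_space UNIV) Y =
    - (\<Sum>y\<in>S. \<P>(\<omega> in M. Y \<omega> = y) * log b (\<P>(\<omega> in M. Y \<omega> = y)))"
proof -
  have zero: "\<P>(\<omega> in M. Y \<omega> = y) = 0" if "y \<notin> S" for y
    using S(2) that by (metis (mono_tags, lifting) Collect_empty_eq measure_empty)
  have "distributed M (count_space UNIV) Y (\<lambda>y. \<P>(\<omega> in M. Y \<omega> = y))"
    unfolding distributed_def
  proof (intro conjI Y)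
    show "distr M (count_space UNIV) Y = density (count_space UNIV) (\<lambda>y. ennreal (\<P>(\<omega> in M. Y \<omega> = y)))"
    proof (rule measure_eqI)
      fix A assume "A \<in> sets (distr M (count_space UNIV) Y)"
      have "emeasure (distr M (count_space UNIV) Y) A = prob (\<Union>y\<in>S \<inter> A. {\<omega> \<in> space M. Y \<omega> = y})"
        using Y S by (subst emeasure_distr) (auto simp: emeasure_eq_measure intro!: arg_cong[where f=prob])
      also have "\<dots> = (\<Sum>y\<in>S \<inter> A. \<P>(\<omega> in M. Y \<omega> = y))"
        using S(1) Y by (subst finite_measure_finite_Union)
          (auto simp: disjoint_family_on_def intro!: measurable_sets_Collect[OF Y])
      also have "ennreal (\<Sum>y\<in>S \<inter> A. \<P>(\<omega> in M. Y \<omega> = y)) = (\<Sum>y\<in>S \<inter> A. ennreal (\<P>(\<omega> in M. Y \<omega> = y)))"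
        by (simp add: sum_ennreal)
      also have "\<dots> = (\<integral>\<^sup>+y. ennreal (\<P>(\<omega> in M. Y \<omega> = y)) * indicator A y \<partial>count_space UNIV)"
        using S zero by (subst nn_integral_count_space'[of "S \<inter> A"]) (auto simp: indicator_def)
      finally show "emeasure (distr M (count_space UNIV) Y) A =
          emeasure (density (count_space UNIV) (\<lambda>y. ennreal (\<P>(\<omega> in M. Y \<omega> = y)))) A"
        by (simp add: emeasure_density)
    qed simp
  qed simp
  then have "entropy b (count_space UNIV) Y =
      - (\<integral>y. \<P>(\<omega> in M. Y \<omega> = y) * log b (\<P>(\<omega> in M. Y \<omega> = y)) \<partial>count_space UNIV)"
    by (rule entropy_distr) simp
  also have "(\<integral>y. \<P>(\<omega> in M. Y \<omega> = y) * log b (\<P>(\<omega> in M. Y \<omega> = y)) \<partial>count_space UNIV) =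
      (\<Sum>y\<in>S. \<P>(\<omega> in M. Y \<omega> = y) * log b (\<P>(\<omega> in M. Y \<omega> = y)))"
    using S zero
    by (subst lebesgue_integral_count_space_finite_support)
       (auto intro!: sum.mono_neutral_left finite_subset[OF _ S(1)])
  finally show ?thesis .
qed

section \<open>Posterior entropy under a uniform prior\<close>

locale uniform_objects = prob_space M for M :: "'w measure" +
  fixes k :: nat and \<theta> :: "nat \<Rightarrow> 'w \<Rightarrow> real"
  assumes k_pos: "0 < k"
    and indep: "indep_vars (\<lambda>_. borel) \<theta> {..<k}"
    and uniform: "\<And>i. i < k \<Longrightarrow> distributed M lborel (\<theta> i) (indicator {0<..1})"
begin

definition history_event :: "history \<Rightarrow> 'w set" where
  "history_event h = {\<omega> \<in> space M. \<forall>(A, x)\<in>set h. answer k \<theta> A \<omega> = x}"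

abbreviation (input) borel_questions :: "history \<Rightarrow> bool" where
  "borel_questions h \<equiv> fst ` set h \<subseteq> sets borel"

lemma measurable_object[measurable]: "i < k \<Longrightarrow> \<theta> i \<in> borel_measurable M"
  using distributed_measurable[OF uniform] by simp

lemma measurable_answer[measurable]:
  assumes "A \<in> sets borel"
  shows "answer k \<theta> A \<in> M \<rightarrow>\<^sub>M count_space UNIV"
proof -
  have [measurable]: "(indicator A :: real \<Rightarrow> nat) \<in> borel \<rightarrow>\<^sub>M count_space UNIV"
    using assms unfolding indicator_def[abs_def] by measurable
  have "(\<lambda>\<omega>. \<Sum>i<k. indicator A (\<theta> i \<omega>) :: nat) \<in> M \<rightarrow>\<^sub>M count_space UNIV"
    by measurable
  then show ?thesis
    by (simp add: answer_def[abs_def])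
qed

lemma answer_le: "answer k \<theta> A \<omega> \<le> k"
proof -
  have "answer k \<theta> A \<omega> \<le> (\<Sum>i<k. 1)"
    unfolding answer_def by (intro sum_mono) (auto simp: indicator_def)
  then show ?thesis by simp
qed

lemma history_event_sets[measurable]:
  assumes "borel_questions h"
  shows "history_event h \<in> events"
proof -
  \<comment> \<open>The empty history is split off because an intersection over no questions is the
    universe rather than the sample space.\<close>
  have "history_event h = (if h = [] then space M else (\<Inter>z\<in>set h. {\<omega> \<in> space M. answer k \<theta> (fst z) \<omega> = snd z}))"
    by (cases h) (auto simp: history_event_def case_prod_beta)
  also have "\<dots> \<in> events"
    using assms by (auto intro!: sets.finite_INT measurable_sets_Collect[OF measurable_answer])
  finally show ?thesis .
qed

lemma given_eq: "given M k \<theta> h = uniform_measure M (history_event h)"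
  by (simp add: given_def history_event_def)

lemma prob_space_given: "0 < prob (history_event h) \<Longrightarrow> prob_space (given M k \<theta> h)"
  unfolding given_eq by (intro prob_space_uniform_measure) (auto simp: emeasure_eq_measure)

lemma space_given[simp]: "space (given M k \<theta> h) = space M"
  and sets_given[simp, measurable_cong]: "sets (given M k \<theta> h) = sets M"
  by (simp_all add: given_eq)

section \<open>Conditional probabilities and entropy of the next answer\<close>

lemma history_event_snoc:
  "history_event (h @ [(A, x)]) = history_event h \<inter> {\<omega> \<in> space M. answer k \<theta> A \<omega> = x}"
  by (auto simp: history_event_def)

lemma answer_prob_eq:
  assumes "0 < prob (history_event h)" "A \<in> sets borel"
  shows "answer_prob M k \<theta> h A x = prob (history_event (h @ [(A, x)])) / prob (history_event h)"
  using assms unfolding answer_prob_def history_event_snoc given_eq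
  by (subst measure_uniform_measure)
     (auto simp: emeasure_eq_measure intro!: measurable_sets_Collect[OF measurable_answer])

lemma sum_answer_prob:
  assumes "0 < prob (history_event h)" "A \<in> sets borel"
  shows "(\<Sum>x\<le>k. answer_prob M k \<theta> h A x) = 1"
proof -
  interpret G: prob_space "given M k \<theta> h" using assms by (intro prob_space_given)
  show ?thesis
    using G.expectation_finite_range[of "{..k}" "answer k \<theta> A" "\<lambda>_. 1"] assms G.prob_space
    by (simp add: answer_le answer_prob_def)
qed

lemma answer_entropy_eq:
  assumes "0 < prob (history_event h)" "A \<in> sets borel"
  shows "answer_entropy M k \<theta> h A =
    - (\<Sum>x\<le>k. answer_prob M k \<theta> h A x * log 2 (answer_prob M k \<theta> h A x))"
proof -
  interpret G: information_space "given M k \<theta> h" 2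
    using prob_space_given[OF assms(1)] by (auto simp: information_space_def information_space_axioms_def)
  have "answer k \<theta> A \<in> given M k \<theta> h \<rightarrow>\<^sub>M count_space UNIV"
    using assms by measurable
  from G.entropy_finite_range[OF this, of "{..k}"] show ?thesis
    by (simp add: answer_entropy_def answer_prob_def answer_le)
qed

section \<open>Law of the location vector and entropy of the posterior\<close>

lemma distr_objects:
  "distr M (\<Pi>\<^sub>M i\<in>{..<k}. lborel) (\<lambda>\<omega>. \<lambda>i\<in>{..<k}. \<theta> i \<omega>) =
   density (\<Pi>\<^sub>M i\<in>{..<k}. lborel) (indicator (\<Pi>\<^sub>E i\<in>{..<k}. {0<..1}))"
proof -
  let ?P = "\<Pi>\<^sub>M i\<in>{..<k}. (lborel :: real measure)"
  interpret L: product_sigma_finite "\<lambda>_::nat. lborel :: real measure" ..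
  have sets_P: "sets ?P = sets (\<Pi>\<^sub>M i\<in>{..<k}. borel)"
    by (intro sets_PiM_cong) auto
  have distr: "distr M lborel (\<theta> i) = density lborel (indicator {0<..1})" if "i < k" for i
    using uniform[OF that] by (simp add: distributed_def)
  \<comment> \<open>A sigma-finite product needs a measure at every natural index; indices from
    \<open>k\<close> on get Lebesgue measure as a filler.\<close>
  define N where "N = (\<lambda>i. if i < k then distr M lborel (\<theta> i) else lborel)"
  interpret N: product_sigma_finite N
  proof (rule product_sigma_finite.intro)
    fix i show "sigma_finite_measure (N i)"
    proof (cases "i < k")
      case True
      then interpret D: prob_space "N i" unfolding N_def by (simp add: prob_space_distr)
      show ?thesis by unfold_locales
    qed (simp add: N_def lborel.sigma_finite_measure_axioms)
  qed
  have "distr M ?P (\<lambda>\<omega>. \<lambda>i\<in>{..<k}. \<theta> i \<omega>) = distr M (\<Pi>\<^sub>M i\<in>{..<k}. borel) (\<lambda>\<omega>. \<lambda>i\<in>{..<k}. \<theta> i \<omega>)"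
    by (intro distr_cong sets_P) auto
  also have "\<dots> = (\<Pi>\<^sub>M i\<in>{..<k}. distr M borel (\<theta> i))"
    using indep k_pos by (subst indep_vars_iff_distr_eq_PiM'[symmetric]) auto
  also have "\<dots> = PiM {..<k} N"
    by (intro PiM_cong) (auto simp: N_def intro!: distr_cong)
  \<comment> \<open>Independence has made the joint law a product of the coordinate laws. A product
    measure is determined by its values on boxes, and on a box both sides factor into the volumes of
    \<open>{0<..1} \<inter> A i\<close>.\<close>
  also have "\<dots> = density ?P (indicator (\<Pi>\<^sub>E i\<in>{..<k}. {0<..1}))"
  proof (rule N.PiM_eqI[symmetric])
    show "sets (density ?P (indicator (\<Pi>\<^sub>E i\<in>{..<k}. {0<..1}))) = sets (PiM {..<k} N)"
      by (auto simp: N_def intro!: sets_PiM_cong)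
    fix A assume "\<And>i. i \<in> {..<k} \<Longrightarrow> A i \<in> sets (N i)"
    then have A: "A i \<in> sets borel" if "i < k" for i
      using that by (simp add: N_def)
    have box: "(\<Pi>\<^sub>E i\<in>{..<k}. {0<..1}) \<in> sets ?P" "Pi\<^sub>E {..<k} A \<in> sets ?P"
      using A by (auto intro!: sets_PiM_I_finite)
    have "emeasure (density ?P (indicator (\<Pi>\<^sub>E i\<in>{..<k}. {0<..1}))) (Pi\<^sub>E {..<k} A) =
        emeasure ?P (\<Pi>\<^sub>E i\<in>{..<k}. {0<..1} \<inter> A i)"
      using box sets.Int[OF box]
      by (simp add: emeasure_density indicator_inter_arith[symmetric] PiE_Int)
    also have "\<dots> = (\<Prod>i<k. emeasure lborel ({0<..1} \<inter> A i))"
      using A by (subst L.emeasure_PiM) auto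
    also have "\<dots> = (\<Prod>i<k. emeasure (N i) (A i))"
      using A by (intro prod.cong) (auto simp: N_def distr emeasure_density indicator_inter_arith[symmetric])
    finally show "emeasure (density ?P (indicator (\<Pi>\<^sub>E i\<in>{..<k}. {0<..1}))) (Pi\<^sub>E {..<k} A) =
        (\<Prod>i<k. emeasure (N i) (A i))" .
  qed simp
  finally show ?thesis .
qed

text \<open>The prior is Lebesgue measure on the unit box, so conditioning on \<open>h\<close> gives
  the uniform law on the part of the box consistent with \<open>h\<close>. The volume of that part
  is the probability of \<open>h\<close>, and a uniform law has the logarithm of the volume as its
  entropy.\<close>

lemma posterior_entropy_eq:
  assumes h: "borel_questions h" and pos: "0 < prob (history_event h)"
  shows "posterior_entropy M k \<theta> h = log 2 (prob (history_event h))"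
proof -
  let ?P = "\<Pi>\<^sub>M i\<in>{..<k}. (lborel :: real measure)"
  let ?V = "\<lambda>\<omega>. \<lambda>i\<in>{..<k}. \<theta> i \<omega>"
  let ?box = "\<Pi>\<^sub>E i\<in>{..<k}. {0<..1::real}"
  let ?p = "prob (history_event h)"
  interpret G: information_space "given M k \<theta> h" 2
    using prob_space_given[OF pos] by (auto simp: information_space_def information_space_axioms_def)
  define C where "C = {u \<in> space ?P. \<forall>z\<in>set h. (\<Sum>i<k. indicator (fst z) (u i)) = snd z}"
  have V[measurable]: "?V \<in> M \<rightarrow>\<^sub>M ?P"
    by (intro measurable_restrict) auto
  have box[measurable]: "?box \<in> sets ?P"
    by (intro sets_PiM_I_finite) auto
  have C[measurable]: "C \<in> sets ?P"
  proof -
    have [measurable]: "fst z \<in> sets borel" if "z \<in> set h" for z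
      using h that by auto
    have "{u \<in> space ?P. (\<Sum>i<k. indicator (fst z) (u i)) = snd z} \<in> sets ?P" if "z \<in> set h" for z
      using that by measurable
    then show ?thesis
      unfolding C_def by (intro sets.sets_Collect_finite_All) auto
  qed
  have E: "history_event h = ?V -` C \<inter> space M"
    by (auto simp: history_event_def C_def answer_def space_PiM case_prod_beta)
  \<comment> \<open>Probabilities of the history together with a position constraint are volumes
    inside the box. With \<open>B\<close> the whole space this gives the normalising volume; for
    general \<open>B\<close> it gives the posterior law.\<close>
  have law: "emeasure M (history_event h \<inter> (?V -` B \<inter> space M)) = emeasure ?P (?box \<inter> C \<inter> B)"
    if [measurable]: "B \<in> sets ?P" for B
  proof -
    have "emeasure M (history_event h \<inter> (?V -` B \<inter> space M)) = emeasure (distr M ?P ?V) (C \<inter> B)"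
      by (subst emeasure_distr) (auto simp: E intro!: arg_cong2[where f=emeasure])
    then show ?thesis
      by (simp add: distr_objects emeasure_density indicator_inter_arith[symmetric] Int_assoc)
  qed
  have vol: "emeasure ?P (?box \<inter> C) = ?p"
  proof -
    have "history_event h \<inter> (?V -` space ?P \<inter> space M) = history_event h"
      using measurable_space[OF V] by (auto simp: history_event_def)
    moreover have "?box \<inter> C \<inter> space ?P = ?box \<inter> C"
      using sets.sets_into_space[OF C] by auto
    ultimately show ?thesis
      using law[of "space ?P"] by (simp add: emeasure_eq_measure)
  qed
  then have vol': "measure ?P (?box \<inter> C) = ?p"
    by (simp add: measure_def)
  have "distributed (given M k \<theta> h) ?P ?V (\<lambda>u. indicator (?box \<inter> C) u / measure ?P (?box \<inter> C))"
    unfolding distributed_def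
  proof (intro conjI)
    show "distr (given M k \<theta> h) ?P ?V =
        density ?P (\<lambda>u. ennreal (indicator (?box \<inter> C) u / measure ?P (?box \<inter> C)))" (is "_ = ?D")
    proof (rule measure_eqI)
      fix B assume "B \<in> sets (distr (given M k \<theta> h) ?P ?V)"
      then have B[measurable]: "B \<in> sets ?P" by simp
      have "emeasure (distr (given M k \<theta> h) ?P ?V) B = emeasure ?P (?box \<inter> C \<inter> B) / ?p"
        using h by (subst emeasure_distr) (auto simp: given_eq law[symmetric] emeasure_eq_measure)
      also have "\<dots> = (\<integral>\<^sup>+u. indicator (?box \<inter> C \<inter> B) u / ennreal ?p \<partial>?P)"
        by (subst nn_integral_divide) auto
      also have "\<dots> = (\<integral>\<^sup>+u. ennreal (indicator (?box \<inter> C) u / measure ?P (?box \<inter> C)) * indicator B u \<partial>?P)"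
        using pos by (intro nn_integral_cong)
          (auto simp: vol' indicator_def divide_ennreal[symmetric])
      also have "\<dots> = emeasure ?D B"
        by (simp add: emeasure_density)
      finally show "emeasure (distr (given M k \<theta> h) ?P ?V) B = emeasure ?D B" .
    qed simp
  qed (use V in \<open>auto cong: measurable_cong_sets\<close>)
  from G.entropy_uniform[OF this] show ?thesis
    by (simp add: posterior_entropy_def vol')
qed

section \<open>Expected entropy after one more question\<close>

lemma next_entropy_eq_sum:
  assumes "0 < prob (history_event h)" "A \<in> sets borel"
  shows "next_entropy M k \<theta> h A =
    (\<Sum>x\<le>k. answer_prob M k \<theta> h A x * posterior_entropy M k \<theta> (h @ [(A, x)]))"
proof -
  interpret G: prob_space "given M k \<theta> h" using assms by (intro prob_space_given)
  show ?thesis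
    using G.expectation_finite_range[of "{..k}" "answer k \<theta> A" "\<lambda>x. posterior_entropy M k \<theta> (h @ [(A, x)])"] assms
    by (simp add: next_entropy_def answer_le answer_prob_def)
qed

text \<open>A chain rule: the probability of the extended history is that of \<open>h\<close> times
  the conditional probability of the answer. Taking logarithms and averaging over the answers leaves
  the logarithm for \<open>h\<close> minus the answer entropy.\<close>

lemma next_entropy_eq:
  assumes h: "borel_questions h" and pos: "0 < prob (history_event h)" and A: "A \<in> sets borel"
  shows "next_entropy M k \<theta> h A = log 2 (prob (history_event h)) - answer_entropy M k \<theta> h A"
proof -
  let ?q = "answer_prob M k \<theta> h A"
  have "next_entropy M k \<theta> h A = (\<Sum>x\<le>k. ?q x * log 2 (prob (history_event h)) + ?q x * log 2 (?q x))"
    unfolding next_entropy_eq_sum[OF pos A]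
  proof (rule sum.cong)
    fix x
    have q: "?q x = prob (history_event (h @ [(A, x)])) / prob (history_event h)"
      using pos A by (rule answer_prob_eq)
    show "?q x * posterior_entropy M k \<theta> (h @ [(A, x)]) =
        ?q x * log 2 (prob (history_event h)) + ?q x * log 2 (?q x)"
    proof (cases "?q x = 0")
      case False
      then have "0 < prob (history_event (h @ [(A, x)]))"
        unfolding q by (simp add: zero_less_measure_iff)
      moreover from this have "posterior_entropy M k \<theta> (h @ [(A, x)]) = log 2 (prob (history_event (h @ [(A, x)])))"
        using h A by (intro posterior_entropy_eq) auto
      ultimately show ?thesis
        using pos by (simp add: q log_divide_pos algebra_simps)
    qed simp
  qed simp
  also have "\<dots> = log 2 (prob (history_event h)) - answer_entropy M k \<theta> h A"
    using sum_answer_prob[OF pos A] answer_entropy_eq[OF pos A]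
    by (simp add: sum.distrib sum_distrib_right[symmetric])
  finally show ?thesis .
qed

lemma greedy_questions_iff:
  assumes h: "borel_questions h" and pos: "0 < prob (history_event h)"
  shows "A \<in> greedy_questions M k \<theta> h \<longleftrightarrow>
    A \<in> sets borel \<and> (\<forall>B\<in>sets borel. answer_entropy M k \<theta> h B \<le> answer_entropy M k \<theta> h A)"
  by (auto simp: greedy_questions_def is_arg_min_def next_entropy_eq[OF h pos] not_less)

section \<open>Histories produced by a policy\<close>

lemma length_answers[simp]: "length (answers k \<theta> p n \<omega>) = n"
  by (induction n) auto

lemma set_answers: "set (answers k \<theta> p n \<omega>) \<subseteq> {..k}"
  by (induction n) (auto simp: answer_le)

lemma history_of_snoc: "history_of p (xs @ [x]) = history_of p xs @ [(p xs, x)]"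
  by (auto simp: history_of_def nth_append)

text \<open>Adaptive questioning reduces to fixed questions: as long as the answers agree with
  \<open>xs\<close>, the questions asked are those that \<open>p\<close> assigns to the prefixes of
  \<open>xs\<close>. The induction runs over the last answer.\<close>

lemma answers_eq_iff:
  "answers k \<theta> p (length xs) \<omega> = xs \<longleftrightarrow> (\<forall>(A, x)\<in>set (history_of p xs). answer k \<theta> A \<omega> = x)"
  by (induction xs rule: rev_induct) (auto simp: history_of_snoc, simp add: history_of_def)

lemma history_event_history_of:
  "history_event (history_of p xs) = {\<omega> \<in> space M. answers k \<theta> p (length xs) \<omega> = xs}"
  by (auto simp: history_event_def answers_eq_iff)

lemma borel_questions_history_of: "(\<And>xs. p xs \<in> sets borel) \<Longrightarrow> borel_questions (history_of p xs)"
  by (auto simp: history_of_def)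

text \<open>The outcomes are sorted by the first \<open>n\<close> answers \<open>xs\<close> and the
  last answer \<open>x\<close>. For fixed \<open>xs\<close>, averaging over \<open>x\<close> is
  exactly \<open>next_entropy\<close>, so the expected entropy after \<open>n + 1\<close> questions
  is a weighted sum of one-step values.\<close>

lemma expectation_posterior_entropy_Suc:
  assumes p: "\<And>xs. p xs \<in> sets borel"
  shows "expectation (\<lambda>\<omega>. posterior_entropy M k \<theta> (history_of p (answers k \<theta> p (Suc n) \<omega>))) =
    (\<Sum>xs | set xs \<subseteq> {..k} \<and> length xs = n.
       prob (history_event (history_of p xs)) * next_entropy M k \<theta> (history_of p xs) (p xs))"
proof -
  let ?L = "{xs. set xs \<subseteq> {..k} \<and> length xs = n}"
  let ?h = "history_of p"
  let ?Y = "\<lambda>\<omega>. (answers k \<theta> p n \<omega>, answer k \<theta> (p (answers k \<theta> p n \<omega>)) \<omega>)"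
  have event: "{\<omega> \<in> space M. ?Y \<omega> = (xs, x)} = history_event (?h xs @ [(p xs, x)])" if "xs \<in> ?L" for xs x
    using that by (auto simp: history_event_snoc history_event_history_of)
  have "expectation (\<lambda>\<omega>. posterior_entropy M k \<theta> (?h (answers k \<theta> p (Suc n) \<omega>))) =
      expectation (\<lambda>\<omega>. (\<lambda>(xs, x). posterior_entropy M k \<theta> (?h xs @ [(p xs, x)])) (?Y \<omega>))"
    by (simp add: history_of_snoc)
  also have "\<dots> = (\<Sum>y\<in>?L \<times> {..k}. \<P>(\<omega> in M. ?Y \<omega> = y) *
      (\<lambda>(xs, x). posterior_entropy M k \<theta> (?h xs @ [(p xs, x)])) y)"
  proof (rule expectation_finite_range)
    show "finite (?L \<times> {..k})"
      by (intro finite_cartesian_product finite_lists_length_eq) auto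
    show "?Y \<omega> \<in> ?L \<times> {..k}" for \<omega>
      using set_answers[of p n \<omega>] by (simp add: answer_le)
    fix y assume "y \<in> ?L \<times> {..k}"
    then obtain xs x where "y = (xs, x)" "xs \<in> ?L" by blast
    then show "{\<omega> \<in> space M. ?Y \<omega> = y} \<in> events"
      using p borel_questions_history_of[of p xs] by (auto simp only: event intro!: history_event_sets) auto
  qed
  also have "\<dots> = (\<Sum>xs\<in>?L. \<Sum>x\<le>k. prob (history_event (?h xs @ [(p xs, x)])) *
      posterior_entropy M k \<theta> (?h xs @ [(p xs, x)]))"
    unfolding sum.cartesian_product by (intro sum.cong refl, elim SigmaE, hypsubst) (simp only: event prod.case)
  also have "\<dots> = (\<Sum>xs\<in>?L. prob (history_event (?h xs)) * next_entropy M k \<theta> (?h xs) (p xs))"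
  proof (rule sum.cong)
    fix xs
    show "(\<Sum>x\<le>k. prob (history_event (?h xs @ [(p xs, x)])) * posterior_entropy M k \<theta> (?h xs @ [(p xs, x)])) =
        prob (history_event (?h xs)) * next_entropy M k \<theta> (?h xs) (p xs)"
    \<comment> \<open>Conditioning is meaningless on a null history. There both sides are zero,
      since every extension of a null history is null.\<close>
    proof (cases "prob (history_event (?h xs)) = 0")
      case True
      have "prob (history_event (?h xs @ [(p xs, x)])) \<le> prob (history_event (?h xs))" for x
        using p borel_questions_history_of[of p xs]
        by (intro finite_measure_mono) (auto simp: history_event_snoc)
      then have "prob (history_event (?h xs @ [(p xs, x)])) = 0" for x
        using True by (metis measure_le_0_iff)
      then show ?thesis
        using True by simp
    next
      case False
      then have pos: "0 < prob (history_event (?h xs))"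
        by (simp add: zero_less_measure_iff)
      show ?thesis
        using pos by (simp add: next_entropy_eq_sum[OF pos p] answer_prob_eq[OF pos p] sum_distrib_left)
    qed
  qed simp
  finally show ?thesis .
qed

end

section \<open>Entropy bounds\<close>

lemma pmf_poisson_binomial_2:
  assumes "p \<in> {0..1}" "q \<in> {0..1}"
  shows "pmf (poisson_binomial_pmf [p, q]) x =
    (if x = 0 then (1 - p) * (1 - q) else if x = 1 then p * (1 - q) + (1 - p) * q
     else if x = 2 then p * q else 0)"
proof -
  have "{..<length [p, q]} = insert 0 {1::nat}" by auto
  then have "poisson_binomial_pmf [p, q] =
      map_pmf (\<lambda>W. \<Sum>i\<in>insert 0 {1}. of_bool (W i)) (Pi_pmf (insert 0 {1}) False (\<lambda>i. bernoulli_pmf ([p, q] ! i)))"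
    unfolding poisson_binomial_pmf_def by simp
  also have "\<dots> = map_pmf (\<lambda>(a, b). of_bool a + of_bool b) (pair_pmf (bernoulli_pmf p) (bernoulli_pmf q))"
    by (subst Pi_pmf_insert) (auto simp: Pi_pmf_singleton pair_map_pmf2 map_pmf_comp intro!: map_pmf_cong)
  also have "\<dots> = bernoulli_pmf p \<bind> (\<lambda>a. bernoulli_pmf q \<bind> (\<lambda>b. return_pmf (of_bool a + of_bool b)))"
    by (simp add: pair_pmf_def map_pmf_def bind_assoc_pmf bind_return_pmf)
  finally show ?thesis
    using assms by (auto simp: pmf_bind indicator_def)
qed

lemma pmf_binomial_2:
  assumes "p \<in> {0..1}"
  shows "pmf (binomial_pmf 2 p) x = pmf (poisson_binomial_pmf [p, p]) x"
  unfolding pmf_poisson_binomial_2[OF assms assms]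
  using assms by (auto simp: pmf_binomial power2_eq_square choose_two binomial_eq_0)

lemma log_2_quarter: "log 2 (1 / 4) = - 2"
  using log2_of_power_eq[of 4 2] by (simp add: log_divide_pos)

lemma sum_atMost_2: "(\<Sum>x\<le>2. f x) = f 0 + f 1 + f (2::nat)" for f :: "nat \<Rightarrow> real"
  by (simp add: numeral_2_eq_2)

text \<open>Gibbs' inequality against the uniform distribution: \<open>ln t \<le> t - 1\<close> is
  applied at \<open>t = 1 / (n * p x)\<close>, and the resulting errors \<open>1 / n - p x\<close>
  sum to zero.\<close>

lemma entropy_le_log_card:
  fixes p :: "'b \<Rightarrow> real"
  assumes S: "finite S" and p: "\<And>x. x \<in> S \<Longrightarrow> 0 \<le> p x" "(\<Sum>x\<in>S. p x) = 1"
  shows "- (\<Sum>x\<in>S. p x * log 2 (p x)) \<le> log 2 (card S)"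
proof -
  define n where "n = real (card S)"
  have n: "0 < n"
    using S p(2) by (auto simp: n_def card_gt_0_iff)
  have "- (p x * ln (p x)) \<le> p x * ln n + (1 / n - p x)" if "x \<in> S" for x
  proof (cases "p x = 0")
    case False
    then have px: "0 < p x" using p(1)[OF that] by simp
    then have "- ln (p x) - ln n \<le> 1 / (n * p x) - 1"
      using ln_le_minus_one[of "1 / (n * p x)"] n by (simp add: ln_div ln_mult)
    then have "p x * (- ln (p x) - ln n) \<le> p x * (1 / (n * p x) - 1)"
      using px by (intro mult_left_mono) auto
    also have "\<dots> = 1 / n - p x"
      using px n by (simp add: field_simps)
    finally show ?thesis by (simp add: algebra_simps)
  qed (use n in simp)
  then have "(\<Sum>x\<in>S. - (p x * ln (p x))) \<le> (\<Sum>x\<in>S. p x * ln n + (1 / n - p x))"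
    by (rule sum_mono)
  also have "\<dots> = ln n"
    using p(2) n by (simp add: sum.distrib sum_subtractf sum_distrib_right[symmetric] n_def)
  finally have "- (\<Sum>x\<in>S. p x * ln (p x)) \<le> ln n"
    by (simp add: sum_negf)
  then have "- (\<Sum>x\<in>S. p x * ln (p x)) / ln 2 \<le> ln n / ln 2"
    by (intro divide_right_mono) auto
  then show ?thesis
    by (simp add: log_def n_def sum_divide_distrib)
qed

text \<open>The constant \<open>1/4\<close> is half the minimum on \<open>(0, 2]\<close> of the second derivative of \<open>x ln x\<close>.\<close>

lemma x_ln_x_ge_quadratic:
  fixes x :: real
  assumes "0 < x" "x \<le> 2"
  shows "x - 1 + (x - 1)\<^sup>2 / 4 \<le> x * ln x"
proof -
  define f where "f = (\<lambda>x::real. x * ln x - (x - 1) - (x - 1)\<^sup>2 / 4)"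
  have deriv: "(f has_real_derivative ln y - (y - 1) / 2) (at y)" if "0 < y" for y
    unfolding f_def using that
    by (auto intro!: derivative_eq_intros simp: field_simps)
  \<comment> \<open>\<open>f\<close> vanishes at 1, and its derivative is nonpositive on (0, 1] and
    nonnegative on [1, 2], so 1 is its minimum.\<close>
  have "f 1 \<le> f x"
  proof (cases "1 \<le> x")
    case True
    show ?thesis
    proof (rule DERIV_nonneg_imp_nondecreasing[OF True], intro exI conjI)
      fix y assume y: "1 \<le> y" "y \<le> x"
      then show "(f has_real_derivative ln y - (y - 1) / 2) (at y)"
        using deriv by simp
      \<comment> \<open>This is where the upper bound 2 on \<open>x\<close> enters.\<close>
      have "(y - 1) / 2 \<le> (y - 1) / y"
        using y assms by (intro divide_left_mono) auto
      also have "\<dots> = 1 - 1 / y" using y by (simp add: field_simps)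
      also have "\<dots> \<le> ln y" using ln_le_minus_one[of "1 / y"] y by (simp add: ln_div)
      finally show "0 \<le> ln y - (y - 1) / 2" by simp
    qed
  next
    case False
    then have "x \<le> 1" by simp
    then show ?thesis
    proof (rule DERIV_nonpos_imp_nonincreasing, intro exI conjI)
      fix y assume y: "x \<le> y" "y \<le> 1"
      then show "(f has_real_derivative ln y - (y - 1) / 2) (at y)"
        using deriv assms by simp
      show "ln y - (y - 1) / 2 \<le> 0"
        using ln_le_minus_one[of y] y assms by simp
    qed
  qed
  then show ?thesis by (simp add: f_def)
qed

lemma entropy_poisson_binomial_2_le:
  assumes q: "q \<in> {0..1}"
  defines "p \<equiv> pmf (poisson_binomial_pmf [q, q])"
  shows "- (\<Sum>x\<le>2. p x * log 2 (p x)) \<le> 3 / 2"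
proof (cases "q = 0 \<or> q = 1")
  case True
  then show ?thesis
    unfolding p_def sum_atMost_2 by (auto simp: pmf_poisson_binomial_2)
next
  case False
  with q have q: "0 < q" "q < 1" by auto
  have p: "p 0 = (1 - q)\<^sup>2" "p 1 = 2 * q * (1 - q)" "p 2 = q\<^sup>2"
    using q by (simp_all add: p_def pmf_poisson_binomial_2 power2_eq_square)
  have "- (\<Sum>x\<le>2. p x * ln (p x)) =
      - 2 * (q * ln q + (1 - q) * ln (1 - q)) - 2 * q * (1 - q) * ln 2"
    using q unfolding sum_atMost_2 p by (simp add: ln_mult ln_realpow) (simp add: algebra_simps power2_eq_square)
  \<comment> \<open>The quadratic bound is added at \<open>2 * q\<close> and at
    \<open>2 * (1 - q)\<close>: the linear terms cancel, and the two squares together give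
    \<open>2 * (q - 1/2)\<^sup>2\<close>.\<close>
  moreover have "q * ln q + (1 - q) * ln (1 - q) \<ge> (q - 1 / 2)\<^sup>2 - ln 2"
  proof -
    have ln: "ln (2 * q) = ln 2 + ln q" "ln (2 * (1 - q)) = ln 2 + ln (1 - q)"
      using q by (intro ln_mult_pos; simp)+
    have "2 * q - 1 + (2 * q - 1)\<^sup>2 / 4 \<le> 2 * q * (ln 2 + ln q)"
      "2 * (1 - q) - 1 + (2 * (1 - q) - 1)\<^sup>2 / 4 \<le> 2 * (1 - q) * (ln 2 + ln (1 - q))"
      using q by (intro x_ln_x_ge_quadratic[of "2 * q", unfolded ln] x_ln_x_ge_quadratic[of "2 * (1 - q)", unfolded ln]; simp)+
    then show ?thesis
      by (simp add: field_simps power2_eq_square)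
  qed
  \<comment> \<open>Since \<open>q * (1 - q) = 1/4 - (q - 1/2)\<^sup>2\<close>, the entropy in nats
    is at most \<open>3/2 * ln 2 - 2 * (1 - ln 2) * (q - 1/2)\<^sup>2\<close>, and
    \<open>ln 2 < 1\<close> makes the last term harmless.\<close>
  moreover have "ln 2 * (q - 1 / 2)\<^sup>2 \<le> (q - 1 / 2)\<^sup>2"
    using mult_right_mono[of "ln 2" 1 "(q - 1 / 2)\<^sup>2"] ln_2_less_1 by simp
  ultimately have "- (\<Sum>x\<le>2. p x * ln (p x)) \<le> 3 / 2 * ln 2"
    by (simp add: algebra_simps power2_eq_square)
  then show ?thesis
    by (simp add: log_def sum_divide_distrib[symmetric] pos_divide_le_eq)
       (simp add: field_simps)
qed

text \<open>This is 2^3 < 3^2 after doubling and exponentiating.\<close>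

lemma log_2_3_gt: "log 2 3 > (1.5 :: real)"
proof -
  have "log 2 8 < log 2 (9::real)" by simp
  moreover have "log 2 8 = (3::real)" using log2_of_power_eq[of 8 3] by simp
  moreover have "log 2 9 = 2 * log 2 (3::real)" using log_nat_power[of 3 2 2] by simp
  ultimately show ?thesis by simp
qed

section \<open>Two objects\<close>

text \<open>The law of a single object under the uniform prior.\<close>

definition vol :: "real set \<Rightarrow> real" where
  "vol B = measure lborel (B \<inter> {0<..1})"

lemma emeasure_vol: "emeasure lborel (B \<inter> {0<..1}) = vol B"
proof -
  have "emeasure lborel (B \<inter> {0<..1}) \<le> emeasure lborel {0<..1::real}"
    by (intro emeasure_mono) auto
  then have "emeasure lborel (B \<inter> {0<..1}) \<noteq> \<infinity>"
    by (auto simp: top_unique)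
  then show ?thesis
    unfolding vol_def by (intro emeasure_eq_ennreal_measure) simp
qed

lemma vol_nonneg: "0 \<le> vol B"
  by (simp add: vol_def)

lemma vol_Diff:
  assumes "A \<in> sets borel" "B \<in> sets borel"
  shows "vol (A - B) = vol A - vol (A \<inter> B)"
proof -
  have "vol A = vol ((A - B) \<union> (A \<inter> B))" by (intro arg_cong[where f=vol]) auto
  also have "\<dots> = measure lborel ((A - B) \<inter> {0<..1}) + measure lborel (A \<inter> B \<inter> {0<..1})"
    unfolding vol_def Int_Un_distrib2
    using assms by (intro measure_Union) (auto simp: emeasure_vol)
  finally show ?thesis by (simp add: vol_def)
qed

lemma vol_Int_le: "A \<in> sets borel \<Longrightarrow> B \<in> sets borel \<Longrightarrow> vol (A \<inter> B) \<le> vol A"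
  using vol_Diff[of A B] vol_nonneg[of "A - B"] by simp

lemma vol_empty[simp]: "vol {} = 0"
  by (simp add: vol_def)

lemma vol_eqI: "B \<inter> {0<..1} = {a<..b} \<Longrightarrow> a \<le> b \<Longrightarrow> vol B = b - a"
  by (simp add: vol_def)

text \<open>The probability that an object uniform on the cell \<open>C\<close> lies in
  \<open>A\<close>. A null cell yields 0 by the convention for division, which keeps the value in
  [0, 1] for every cell.\<close>

definition cell_fraction :: "real set \<Rightarrow> real set \<Rightarrow> real" where
  "cell_fraction C A = vol (C \<inter> A) / vol C"

lemma cell_fraction_range: "A \<in> sets borel \<Longrightarrow> C \<in> sets borel \<Longrightarrow> cell_fraction C A \<in> {0..1}"
  unfolding cell_fraction_def using vol_Int_le[of C A] vol_nonneg
  by (auto simp: divide_le_eq_1 less_le)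

section \<open>Two independent objects confined to cells\<close>

locale two_uniform_objects = uniform_objects M 2 \<theta> for M :: "'w measure" and \<theta>
begin

lemma answer_2: "answer 2 \<theta> A \<omega> = indicator A (\<theta> 0 \<omega>) + indicator A (\<theta> 1 \<omega>)"
  by (simp add: answer_def numeral_2_eq_2)

lemma answer_2_eq_iff:
  "answer 2 \<theta> A \<omega> = 0 \<longleftrightarrow> \<theta> 0 \<omega> \<notin> A \<and> \<theta> 1 \<omega> \<notin> A"
  "answer 2 \<theta> A \<omega> = 1 \<longleftrightarrow> (\<theta> 0 \<omega> \<in> A \<longleftrightarrow> \<theta> 1 \<omega> \<notin> A)"
  "answer 2 \<theta> A \<omega> = 2 \<longleftrightarrow> \<theta> 0 \<omega> \<in> A \<and> \<theta> 1 \<omega> \<in> A"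
  by (simp_all add: answer_2 indicator_def)

lemma measurable_objects[measurable]: "\<theta> 0 \<in> borel_measurable M" "\<theta> 1 \<in> borel_measurable M"
  by (simp_all add: measurable_object)

lemma prob_object:
  assumes "i < 2" "B \<in> sets borel"
  shows "\<P>(\<omega> in M. \<theta> i \<omega> \<in> B) = vol B"
proof -
  have "ennreal (\<P>(\<omega> in M. \<theta> i \<omega> \<in> B)) = emeasure M (\<theta> i -` B \<inter> space M)"
    by (auto simp: emeasure_eq_measure intro!: arg_cong[where f=prob])
  also have "\<dots> = (\<integral>\<^sup>+x. indicator {0<..1} x * indicator B x \<partial>lborel)"
    using assms by (intro distributed_emeasure uniform) auto
  also have "\<dots> = emeasure lborel (B \<inter> {0<..1})"
    using assms by (simp add: indicator_inter_arith[symmetric] Int_commute)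
  finally show ?thesis
    by (simp add: emeasure_vol vol_nonneg)
qed

definition pair_event :: "real set \<Rightarrow> real set \<Rightarrow> 'w set" where
  "pair_event B C = {\<omega> \<in> space M. \<theta> 0 \<omega> \<in> B \<and> \<theta> 1 \<omega> \<in> C}"

lemma pair_event_sets[measurable]:
  assumes [measurable]: "B \<in> sets borel" "C \<in> sets borel"
  shows "pair_event B C \<in> events"
  unfolding pair_event_def by measurable

lemma prob_pair_event:
  assumes "B \<in> sets borel" "C \<in> sets borel"
  shows "prob (pair_event B C) = vol B * vol C"
proof -
  have "pair_event B C = (\<Inter>i\<in>{..<2::nat}. \<theta> i -` (if i = 0 then B else C) \<inter> space M)"
    by (auto simp: pair_event_def numeral_2_eq_2 less_Suc_eq)
  also have "prob \<dots> = (\<Prod>i<2::nat. prob (\<theta> i -` (if i = 0 then B else C) \<inter> space M))"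
    using assms by (intro indep_varsD_finite[OF indep]) (auto simp: lessThan_empty_iff)
  also have "\<dots> = (\<Prod>i<2::nat. vol (if i = 0 then B else C))"
  proof (rule prod.cong)
    fix i :: nat assume "i \<in> {..<2}"
    then show "prob (\<theta> i -` (if i = 0 then B else C) \<inter> space M) = vol (if i = 0 then B else C)"
      using prob_object[of i "if i = 0 then B else C"] assms
      by (simp add: vimage_def Int_def conj_commute)
  qed simp
  finally show ?thesis by (simp add: numeral_2_eq_2)
qed

text \<open>Given the pair event the objects are independent and uniform on \<open>B\<close> and
  \<open>C\<close>, so the answer is a sum of two independent Bernoulli variables. The proof splits
  each cell into its parts inside and outside \<open>A\<close> and treats the possible answers in
  turn.\<close>

lemma prob_pair_event_answer:
  assumes [measurable]: "B \<in> sets borel" "C \<in> sets borel" "A \<in> sets borel" and pos: "0 < vol B" "0 < vol C"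
  shows "prob (pair_event B C \<inter> {\<omega> \<in> space M. answer 2 \<theta> A \<omega> = x}) =
    vol B * vol C * pmf (poisson_binomial_pmf [cell_fraction B A, cell_fraction C A]) x"
proof -
  define b c where "b = vol (B \<inter> A)" and "c = vol (C \<inter> A)"
  have vol: "vol (B - A) = vol B - b" "vol (C - A) = vol C - c"
    by (simp_all add: vol_Diff b_def c_def)
  note pb = pmf_poisson_binomial_2[OF cell_fraction_range[OF assms(3,1)] cell_fraction_range[OF assms(3,2)]]
  let ?E = "pair_event B C \<inter> {\<omega> \<in> space M. answer 2 \<theta> A \<omega> = x}"
  consider "x = 0" | "x = 1" | "x = 2" | "2 < x" by linarith
  then show ?thesis
  proof cases
    case 1
    then have "?E = pair_event (B - A) (C - A)"
      unfolding pair_event_def by (simp only: answer_2_eq_iff) blast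
    then have "prob ?E = (vol B - b) * (vol C - c)"
      by (simp add: prob_pair_event vol)
    then show ?thesis
      unfolding pb unfolding cell_fraction_def b_def[symmetric] c_def[symmetric]
      using pos 1 by (simp add: divide_simps)
  next
    case 2
    then have "?E = pair_event (B \<inter> A) (C - A) \<union> pair_event (B - A) (C \<inter> A)"
      unfolding pair_event_def by (simp only: answer_2_eq_iff) blast
    also have "prob \<dots> = prob (pair_event (B \<inter> A) (C - A)) + prob (pair_event (B - A) (C \<inter> A))"
      by (intro finite_measure_Union) (measurable, auto simp: pair_event_def)
    also have "\<dots> = b * (vol C - c) + (vol B - b) * c"
      by (simp add: prob_pair_event vol b_def c_def)
    also have "\<dots> = vol B * vol C * (b / vol B * (1 - c / vol C) + (1 - b / vol B) * (c / vol C))"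
      using pos by (simp add: field_simps)
    finally show ?thesis
      unfolding pb unfolding cell_fraction_def b_def[symmetric] c_def[symmetric]
      using 2 by simp
  next
    case 3
    then have "?E = pair_event (B \<inter> A) (C \<inter> A)"
      unfolding pair_event_def by (simp only: answer_2_eq_iff) blast
    then have "prob ?E = b * c"
      by (simp add: prob_pair_event b_def c_def)
    then show ?thesis
      unfolding pb unfolding cell_fraction_def b_def[symmetric] c_def[symmetric]
      using pos 3 by (simp add: field_simps)
  next
    case 4
    then have "?E = {}"
      by (auto simp: answer_2 indicator_def split: if_splits)
    then have "prob ?E = 0" by (simp only: measure_empty)
    then show ?thesis
      unfolding pb using 4 by simp
  qed
qed

lemma answer_entropy_le_log_3:
  assumes "0 < prob (history_event h)" "A \<in> sets borel"
  shows "answer_entropy M 2 \<theta> h A \<le> log 2 3"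
  unfolding answer_entropy_eq[OF assms]
  using entropy_le_log_card[of "{..2::nat}" "answer_prob M 2 \<theta> h A"] sum_answer_prob[OF assms]
  by (simp add: answer_prob_def)

section \<open>Answers after the histories (0, 2) and (1, 1)\<close>

lemma history_event_02: "history_event [(A, 0), (B, 2)] = pair_event (B - A) (B - A)"
  unfolding history_event_def pair_event_def by (simp add: answer_2_eq_iff) blast

text \<open>Each question separates the two objects, so they have complementary membership patterns
  with respect to \<open>A\<close> and \<open>B\<close>; the four patterns of the first object give
  the four pair events.\<close>

lemma history_event_11:
  "history_event [(A, 1), (B, 1)] =
    (pair_event (- (A \<union> B)) (A \<inter> B) \<union> pair_event (A \<inter> B) (- (A \<union> B))) \<union>
    (pair_event (B - A) (A - B) \<union> pair_event (A - B) (B - A))"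
  unfolding history_event_def pair_event_def
  by (auto simp: answer_2_eq_iff(2)[unfolded One_nat_def])

lemma answer_prob_02:
  assumes [measurable]: "A \<in> sets borel" "B \<in> sets borel" "Q \<in> sets borel"
    and pos: "0 < vol (B - A)"
  shows "prob (history_event [(A, 0), (B, 2)]) = (vol (B - A))\<^sup>2"
    and "answer_prob M 2 \<theta> [(A, 0), (B, 2)] Q x =
      pmf (poisson_binomial_pmf [cell_fraction (B - A) Q, cell_fraction (B - A) Q]) x"
proof -
  show prior: "prob (history_event [(A, 0), (B, 2)]) = (vol (B - A))\<^sup>2"
    by (simp add: history_event_02 prob_pair_event power2_eq_square)
  have "0 < prob (history_event [(A, 0), (B, 2)])"
    using pos unfolding prior by simp
  from answer_prob_eq[OF this assms(3)]
  have "answer_prob M 2 \<theta> [(A, 0), (B, 2)] Q x =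
      prob (pair_event (B - A) (B - A) \<inter> {\<omega> \<in> space M. answer 2 \<theta> Q \<omega> = x}) / (vol (B - A))\<^sup>2"
    by (simp only: history_event_snoc history_event_02 prior[unfolded history_event_02])
  also have "\<dots> = pmf (poisson_binomial_pmf [cell_fraction (B - A) Q, cell_fraction (B - A) Q]) x"
    using pos by (subst prob_pair_event_answer) (simp_all add: power2_eq_square)
  finally show "answer_prob M 2 \<theta> [(A, 0), (B, 2)] Q x =
      pmf (poisson_binomial_pmf [cell_fraction (B - A) Q, cell_fraction (B - A) Q]) x" .
qed

text \<open>Total probability over four disjoint pair events, each of probability 1/16. The joint
  probability is computed rather than the conditional one, so that \<open>answer_prob_11\<close> can
  take both numerator and denominator from here.\<close>

lemma prob_history_11_answer:
  assumes [measurable]: "A \<in> sets borel" "B \<in> sets borel" "Q \<in> sets borel"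
    and vol: "vol (- (A \<union> B)) = 1 / 4" "vol (B - A) = 1 / 4" "vol (A - B) = 1 / 4" "vol (A \<inter> B) = 1 / 4"
  shows "prob (history_event [(A, 1), (B, 1)] \<inter> {\<omega> \<in> space M. answer 2 \<theta> Q \<omega> = x}) =
    1 / 16 * (pmf (poisson_binomial_pmf [cell_fraction (- (A \<union> B)) Q, cell_fraction (A \<inter> B) Q]) x +
              pmf (poisson_binomial_pmf [cell_fraction (A \<inter> B) Q, cell_fraction (- (A \<union> B)) Q]) x +
              pmf (poisson_binomial_pmf [cell_fraction (B - A) Q, cell_fraction (A - B) Q]) x +
              pmf (poisson_binomial_pmf [cell_fraction (A - B) Q, cell_fraction (B - A) Q]) x)"
proof -
  define C1 C2 C3 C4 where C: "C1 = - (A \<union> B)" "C2 = B - A" "C3 = A - B" "C4 = A \<inter> B"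
  let ?X = "{\<omega> \<in> space M. answer 2 \<theta> Q \<omega> = x}"
  have C_borel[measurable]: "C1 \<in> sets borel" "C2 \<in> sets borel" "C3 \<in> sets borel" "C4 \<in> sets borel"
    by (simp_all add: C)
  have vol_C: "vol C1 = 1 / 4" "vol C2 = 1 / 4" "vol C3 = 1 / 4" "vol C4 = 1 / 4"
    using vol by (simp_all only: C)
  have X[measurable]: "?X \<in> events"
    by (intro measurable_sets_Collect[OF measurable_answer]) simp_all
  have disj: "C1 \<inter> C2 = {}" "C1 \<inter> C3 = {}" "C1 \<inter> C4 = {}" "C2 \<inter> C3 = {}" "C2 \<inter> C4 = {}" "C3 \<inter> C4 = {}"
    by (auto simp: C)
  have Un: "prob ((D \<union> E) \<union> (F \<union> G)) = (prob D + prob E) + (prob F + prob G)"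
    if "D \<in> events" "E \<in> events" "F \<in> events" "G \<in> events"
      "D \<inter> E = {}" "D \<inter> F = {}" "D \<inter> G = {}" "E \<inter> F = {}" "E \<inter> G = {}" "F \<inter> G = {}" for D E F G
    using that by (simp add: finite_measure_Union Int_Un_distrib Int_Un_distrib2)
  have "history_event [(A, 1), (B, 1)] \<inter> ?X =
      (pair_event C1 C4 \<inter> ?X \<union> pair_event C4 C1 \<inter> ?X) \<union> (pair_event C2 C3 \<inter> ?X \<union> pair_event C3 C2 \<inter> ?X)"
    unfolding history_event_11 C by blast
  moreover have "prob ((pair_event C1 C4 \<inter> ?X \<union> pair_event C4 C1 \<inter> ?X) \<union>
        (pair_event C2 C3 \<inter> ?X \<union> pair_event C3 C2 \<inter> ?X)) =
      (prob (pair_event C1 C4 \<inter> ?X) + prob (pair_event C4 C1 \<inter> ?X)) +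
      (prob (pair_event C2 C3 \<inter> ?X) + prob (pair_event C3 C2 \<inter> ?X))"
  proof -
    have "pair_event D E \<inter> ?X \<in> events" if "D \<in> sets borel" "E \<in> sets borel" for D E
      using pair_event_sets[OF that] X by (rule sets.Int)
    \<comment> \<open>Disjointness can be read off the first object alone: its cell is different in
      each of the four events.\<close>
    moreover have "(pair_event D E \<inter> ?X) \<inter> (pair_event D' E' \<inter> ?X) = {}" if "D \<inter> D' = {}" for D D' E E'
      using that by (auto simp: pair_event_def)
    ultimately show ?thesis
      using disj C_borel by (intro Un) (simp_all only: Int_commute)
  qed
  moreover have "prob (pair_event C1 C4 \<inter> ?X) =
      1 / 16 * pmf (poisson_binomial_pmf [cell_fraction C1 Q, cell_fraction C4 Q]) x"
    by (subst prob_pair_event_answer) (simp_all add: vol_C)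
  moreover have "prob (pair_event C4 C1 \<inter> ?X) =
      1 / 16 * pmf (poisson_binomial_pmf [cell_fraction C4 Q, cell_fraction C1 Q]) x"
    by (subst prob_pair_event_answer) (simp_all add: vol_C)
  moreover have "prob (pair_event C2 C3 \<inter> ?X) =
      1 / 16 * pmf (poisson_binomial_pmf [cell_fraction C2 Q, cell_fraction C3 Q]) x"
    by (subst prob_pair_event_answer) (simp_all add: vol_C)
  moreover have "prob (pair_event C3 C2 \<inter> ?X) =
      1 / 16 * pmf (poisson_binomial_pmf [cell_fraction C3 Q, cell_fraction C2 Q]) x"
    by (subst prob_pair_event_answer) (simp_all add: vol_C)
  ultimately show ?thesis
    unfolding C by (simp only: distrib_left add.assoc)
qed

lemma answer_prob_11:
  assumes [measurable]: "A \<in> sets borel" "B \<in> sets borel" "Q \<in> sets borel"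
    and vol: "vol (- (A \<union> B)) = 1 / 4" "vol (B - A) = 1 / 4" "vol (A - B) = 1 / 4" "vol (A \<inter> B) = 1 / 4"
  shows "prob (history_event [(A, 1), (B, 1)]) = 1 / 4"
    and "answer_prob M 2 \<theta> [(A, 1), (B, 1)] Q x =
     1 / 4 * (pmf (poisson_binomial_pmf [cell_fraction (- (A \<union> B)) Q, cell_fraction (A \<inter> B) Q]) x +
              pmf (poisson_binomial_pmf [cell_fraction (A \<inter> B) Q, cell_fraction (- (A \<union> B)) Q]) x +
              pmf (poisson_binomial_pmf [cell_fraction (B - A) Q, cell_fraction (A - B) Q]) x +
              pmf (poisson_binomial_pmf [cell_fraction (A - B) Q, cell_fraction (B - A) Q]) x)"
proof -
  \<comment> \<open>Asking the empty set, which is always answered by \<open>0\<close>, does not change the event.\<close>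
  have "history_event [(A, 1), (B, 1)] =
      history_event [(A, 1), (B, 1)] \<inter> {\<omega> \<in> space M. answer 2 \<theta> {} \<omega> = 0}"
    by (auto simp: history_event_def answer_2_eq_iff)
  also have "prob \<dots> = 1 / 4"
    using prob_history_11_answer[OF assms(1,2) _ vol, of "{}" 0]
    by (simp add: cell_fraction_def pmf_poisson_binomial_2)
  finally show prior: "prob (history_event [(A, 1), (B, 1)]) = 1 / 4" .
  have quarter: "1 / 16 * r / (1 / 4) = 1 / 4 * r" for r :: real
    by simp
  from prior have "0 < prob (history_event [(A, 1), (B, 1)])"
    by simp
  from answer_prob_eq[OF this assms(3), of x]
  show "answer_prob M 2 \<theta> [(A, 1), (B, 1)] Q x =
     1 / 4 * (pmf (poisson_binomial_pmf [cell_fraction (- (A \<union> B)) Q, cell_fraction (A \<inter> B) Q]) x +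
              pmf (poisson_binomial_pmf [cell_fraction (A \<inter> B) Q, cell_fraction (- (A \<union> B)) Q]) x +
              pmf (poisson_binomial_pmf [cell_fraction (B - A) Q, cell_fraction (A - B) Q]) x +
              pmf (poisson_binomial_pmf [cell_fraction (A - B) Q, cell_fraction (B - A) Q]) x)"
    by (simp only: history_event_snoc prob_history_11_answer[OF assms] prior quarter)
qed

end

section \<open>The third question\<close>

abbreviation (input) Q1 :: "real set" where "Q1 \<equiv> {1/2<..1}"
abbreviation (input) Q2 :: "real set" where "Q2 \<equiv> {1/4<..1/2} \<union> {3/4<..1}"
abbreviation (input) Q3 :: "real \<Rightarrow> real \<Rightarrow> real set" where
  "Q3 \<alpha> \<beta> \<equiv> {(1 - \<alpha>)/4<..1/4} \<union> {(2 - \<beta>)/4<..1/2} \<union> {(3 - \<beta>)/4<..3/4} \<union> {(4 - \<alpha>)/4<..1}"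

text \<open>The quarters of \<open>(0, 1]\<close> from left to right; \<open>C1\<close> also contains the null set outside \<open>(0, 1]\<close>.\<close>

abbreviation (input) "C1 \<equiv> - (Q1 \<union> Q2)"
abbreviation (input) "C2 \<equiv> Q2 - Q1"
abbreviation (input) "C3 \<equiv> Q1 - Q2"
abbreviation (input) "C4 \<equiv> Q1 \<inter> Q2"

lemma vol_cells: "vol C1 = 1 / 4" "vol C2 = 1 / 4" "vol C3 = 1 / 4" "vol C4 = 1 / 4"
proof -
  show "vol C1 = 1 / 4" using vol_eqI[of C1 0 "1/4"] by force
  show "vol C2 = 1 / 4" using vol_eqI[of C2 "1/4" "1/2"] by force
  show "vol C3 = 1 / 4" using vol_eqI[of C3 "1/2" "3/4"] by force
  show "vol C4 = 1 / 4" using vol_eqI[of C4 "3/4" 1] by force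
qed

text \<open>The third question meets each quarter in its right end, of length \<alpha>/4 in the two
  outer quarters and \<beta>/4 in the two inner ones.\<close>

lemma cell_fraction_Q3:
  assumes "\<alpha> \<in> {0..1}" "\<beta> \<in> {0..1}"
  shows "cell_fraction C1 (Q3 \<alpha> \<beta>) = \<alpha>" "cell_fraction C2 (Q3 \<alpha> \<beta>) = \<beta>"
    "cell_fraction C3 (Q3 \<alpha> \<beta>) = \<beta>" "cell_fraction C4 (Q3 \<alpha> \<beta>) = \<alpha>"
proof -
  have "vol (C1 \<inter> Q3 \<alpha> \<beta>) = \<alpha> / 4"
    using assms by (subst vol_eqI[of _ "(1 - \<alpha>) / 4" "1 / 4"]) (auto simp: field_simps)
  then show "cell_fraction C1 (Q3 \<alpha> \<beta>) = \<alpha>"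
    unfolding cell_fraction_def vol_cells by simp
  have "vol (C2 \<inter> Q3 \<alpha> \<beta>) = \<beta> / 4"
    using assms by (subst vol_eqI[of _ "(2 - \<beta>) / 4" "1 / 2"]) (auto simp: field_simps)
  then show "cell_fraction C2 (Q3 \<alpha> \<beta>) = \<beta>"
    unfolding cell_fraction_def vol_cells by simp
  have "vol (C3 \<inter> Q3 \<alpha> \<beta>) = \<beta> / 4"
    using assms by (subst vol_eqI[of _ "(3 - \<beta>) / 4" "3 / 4"]) (auto simp: field_simps)
  then show "cell_fraction C3 (Q3 \<alpha> \<beta>) = \<beta>"
    unfolding cell_fraction_def vol_cells by simp
  have "vol (C4 \<inter> Q3 \<alpha> \<beta>) = \<alpha> / 4"
    using assms by (subst vol_eqI[of _ "(4 - \<alpha>) / 4" 1]) (auto simp: field_simps)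
  then show "cell_fraction C4 (Q3 \<alpha> \<beta>) = \<alpha>"
    unfolding cell_fraction_def vol_cells by simp
qed

lemma dyadic_question_1: "dyadic_question 1 = Q1"
  by (simp add: dyadic_question_def)

lemma dyadic_question_2: "dyadic_question 2 = Q2"
proof -
  have "{1..2 ^ (2 - 1)} = {1, 2::nat}" by auto
  then show ?thesis by (simp add: dyadic_question_def)
qed

lemma dyadic_question_3: "dyadic_question 3 = Q3 (1/2) (1/2)"
proof -
  have "{1..2 ^ (3 - 1)} = {1, 2, 3, 4::nat}" by auto
  then show ?thesis by (simp add: dyadic_question_def Un_assoc)
qed

lemma (in prob_space) integral_eq_const:
  fixes f :: "'a \<Rightarrow> real"
  assumes "\<And>x. x \<in> space M \<Longrightarrow> f x = c"
  shows "integral\<^sup>L M f = c"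
  using Bochner_Integration.integral_cong[of M M f "\<lambda>_. c"] assms by (simp add: prob_space)

text \<open>For a fixed seed the question is a section of the jointly measurable set in
  \<open>is_policy\<close>.\<close>

lemma policy_borel:
  assumes "is_policy S \<pi>" "s \<in> space S"
  shows "\<pi> s xs \<in> sets borel"
proof -
  have "{(s, y). s \<in> space S \<and> y \<in> \<pi> s xs} \<in> sets (S \<Otimes>\<^sub>M borel)"
    using assms(1) by (simp add: is_policy_def)
  then have "Pair s -` {(s, y). s \<in> space S \<and> y \<in> \<pi> s xs} \<in> sets borel"
    by (rule sets_Pair1)
  also have "Pair s -` {(s, y). s \<in> space S \<and> y \<in> \<pi> s xs} = \<pi> s xs"
    using assms(2) by auto
  finally show ?thesis .
qed

section \<open>The two histories of the example\<close>

context two_uniform_objects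
begin

lemma prob_h02: "prob (history_event [(Q1, 0), (Q2, 2)]) = 1 / 16"
  using answer_prob_02(1)[of Q1 Q2 "{}"] by (simp only: vol_cells sets.Un greaterThanAtMost_borel) (simp add: power2_eq_square)

lemma prob_h11: "prob (history_event [(Q1, 1), (Q2, 1)]) = 1 / 4"
  by (rule answer_prob_11(1)[OF _ _ _ vol_cells, of "{}"]) simp_all

lemma pos_h: "0 < prob (history_event [(Q1, 0), (Q2, 2)])" "0 < prob (history_event [(Q1, 1), (Q2, 1)])"
  unfolding prob_h02 prob_h11 by simp_all

lemma borel_h: "borel_questions [(Q1, x), (Q2, y)]"
  by simp

lemma answer_prob_h02:
  assumes "Q \<in> sets borel"
  shows "answer_prob M 2 \<theta> [(Q1, 0), (Q2, 2)] Q x =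
    pmf (poisson_binomial_pmf [cell_fraction C2 Q, cell_fraction C2 Q]) x"
  by (rule answer_prob_02(2)) (use assms in \<open>simp_all only: vol_cells\<close>, simp_all)

lemma answer_prob_h02_Q3:
  assumes "\<alpha> \<in> {0..1}" "\<beta> \<in> {0..1}"
  shows "answer_prob M 2 \<theta> [(Q1, 0), (Q2, 2)] (Q3 \<alpha> \<beta>) x = pmf (poisson_binomial_pmf [\<beta>, \<beta>]) x"
  by (subst answer_prob_h02) (simp_all only: cell_fraction_Q3[OF assms], simp)

lemma answer_entropy_h02_le:
  assumes "Q \<in> sets borel"
  shows "answer_entropy M 2 \<theta> [(Q1, 0), (Q2, 2)] Q \<le> 3 / 2"
proof -
  have "cell_fraction C2 Q \<in> {0..1}"
    using assms by (intro cell_fraction_range) simp_all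
  from entropy_poisson_binomial_2_le[OF this] show ?thesis
    by (simp only: answer_entropy_eq[OF pos_h(1) assms] answer_prob_h02[OF assms])
qed

lemma answer_entropy_h02_half:
  assumes "\<alpha> \<in> {0..1}"
  shows "answer_entropy M 2 \<theta> [(Q1, 0), (Q2, 2)] (Q3 \<alpha> (1/2)) = 3 / 2"
proof -
  have half: "1 / 2 \<in> {0..1::real}" by simp
  have "Q3 \<alpha> (1/2) \<in> sets borel" by simp
  then have "answer_entropy M 2 \<theta> [(Q1, 0), (Q2, 2)] (Q3 \<alpha> (1/2)) =
      - (\<Sum>x\<le>2. pmf (poisson_binomial_pmf [1/2, 1/2]) x * log 2 (pmf (poisson_binomial_pmf [1/2, 1/2]) x))"
    by (simp only: answer_entropy_eq[OF pos_h(1)] answer_prob_h02_Q3[OF assms half])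
  also have "\<dots> = 3 / 2"
    unfolding sum_atMost_2 pmf_poisson_binomial_2[OF half half]
    by (simp add: log_2_quarter log_divide_pos)
  finally show ?thesis .
qed

text \<open>The dyadic question is the case \<alpha> = \<beta> = 1/2, which attains the bound 3/2
  valid for every Borel question.\<close>

lemma dyadic_greedy_h02: "dyadic_question 3 \<in> greedy_questions M 2 \<theta> [(Q1, 0), (Q2, 2)]"
  unfolding greedy_questions_iff[OF borel_h pos_h(1)] dyadic_question_3
  by (intro conjI ballI; (subst answer_entropy_h02_half)?; (rule answer_entropy_h02_le)?) simp_all

text \<open>History (1, 1) pairs \<open>C1\<close> with \<open>C4\<close> and \<open>C2\<close> with
  \<open>C3\<close>. The third question takes the same fraction of both cells of a pair, so each
  component of the mixture has two equal parameters.\<close>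

lemma answer_prob_h11_Q3:
  assumes "\<alpha> \<in> {0..1}" "\<beta> \<in> {0..1}"
  shows "answer_prob M 2 \<theta> [(Q1, 1), (Q2, 1)] (Q3 \<alpha> \<beta>) x =
     1/4 * pmf (poisson_binomial_pmf [\<alpha>, \<alpha>]) x + 1/4 * pmf (poisson_binomial_pmf [\<beta>, \<beta>]) x +
     1/4 * pmf (poisson_binomial_pmf [\<beta>, \<beta>]) x + 1/4 * pmf (poisson_binomial_pmf [\<alpha>, \<alpha>]) x"
  by (subst answer_prob_11(2)[OF _ _ _ vol_cells]) (simp_all only: cell_fraction_Q3[OF assms], simp_all)

lemma answer_prob_h11_Q3_values:
  assumes "\<alpha> \<in> {0..1}" "\<beta> \<in> {0..1}"
  shows "answer_prob M 2 \<theta> [(Q1, 1), (Q2, 1)] (Q3 \<alpha> \<beta>) 0 = 1/2 * (1 - \<alpha>)\<^sup>2 + 1/2 * (1 - \<beta>)\<^sup>2"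
    "answer_prob M 2 \<theta> [(Q1, 1), (Q2, 1)] (Q3 \<alpha> \<beta>) 1 = \<alpha> * (1 - \<alpha>) + \<beta> * (1 - \<beta>)"
    "answer_prob M 2 \<theta> [(Q1, 1), (Q2, 1)] (Q3 \<alpha> \<beta>) 2 = 1/2 * \<alpha>\<^sup>2 + 1/2 * \<beta>\<^sup>2"
  unfolding answer_prob_h11_Q3[OF assms]
    pmf_poisson_binomial_2[OF assms(1) assms(1)] pmf_poisson_binomial_2[OF assms(2) assms(2)]
  by (simp_all add: power2_eq_square algebra_simps)

text \<open>Requiring \<alpha> + \<beta> = 1 makes the answers 0 and 2 equally likely and gives the
  answer 1 probability 2\<alpha>\<beta>. Setting this to 1/3 means \<alpha>\<beta> = 1/6, whose
  solutions are these two numbers.\<close>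

abbreviation (input) "\<alpha>' \<equiv> (1 + sqrt 3 / 3) / 2"
abbreviation (input) "\<beta>' \<equiv> (1 - sqrt 3 / 3) / 2"

lemma balanced_range: "\<alpha>' \<in> {0..1}" "\<beta>' \<in> {0..1}"
proof -
  have "sqrt 3 \<le> 3" using real_sqrt_le_mono[of 3 9] by simp
  moreover have "- 3 \<le> sqrt 3" by (rule order_trans[of _ 0]) simp_all
  ultimately show "\<alpha>' \<in> {0..1}" "\<beta>' \<in> {0..1}" by simp_all
qed

lemma answer_prob_h11_balanced:
  assumes "x \<in> {0, 1, 2}"
  shows "answer_prob M 2 \<theta> [(Q1, 1), (Q2, 1)] (Q3 \<alpha>' \<beta>') x = 1 / 3"
  using assms answer_prob_h11_Q3_values[OF balanced_range]
  by (elim insertE emptyE; simp only:) (simp_all add: power2_eq_square field_simps)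

lemma answer_entropy_h11_balanced:
  "answer_entropy M 2 \<theta> [(Q1, 1), (Q2, 1)] (Q3 \<alpha>' \<beta>') = log 2 3"
proof -
  have "Q3 \<alpha>' \<beta>' \<in> sets borel" by simp
  then have "answer_entropy M 2 \<theta> [(Q1, 1), (Q2, 1)] (Q3 \<alpha>' \<beta>') = - (3 * (1 / 3 * log 2 (1 / 3)))"
    by (simp only: answer_entropy_eq[OF pos_h(2)] sum_atMost_2 answer_prob_h11_balanced insert_iff simp_thms)
  also have "\<dots> = log 2 3"
    by (simp add: log_divide_pos)
  finally show ?thesis .
qed

lemma answer_entropy_h11_dyadic:
  "answer_entropy M 2 \<theta> [(Q1, 1), (Q2, 1)] (dyadic_question 3) = 1.5"
proof -
  have half: "1 / 2 \<in> {0..1::real}" by simp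
  have "Q3 (1/2) (1/2) \<in> sets borel" by simp
  then have "answer_entropy M 2 \<theta> [(Q1, 1), (Q2, 1)] (Q3 (1/2) (1/2)) =
      - (1/4 * log 2 (1/4) + 1/2 * log 2 (1/2) + 1/4 * log 2 (1/4))"
    by (simp only: answer_entropy_eq[OF pos_h(2)] sum_atMost_2 answer_prob_h11_Q3_values[OF half half])
       (simp add: power2_eq_square)
  also have "\<dots> = 1.5"
    by (simp add: log_2_quarter log_divide_pos)
  finally show ?thesis unfolding dyadic_question_3 .
qed

lemma balanced_greedy_h11: "Q3 \<alpha>' \<beta>' \<in> greedy_questions M 2 \<theta> [(Q1, 1), (Q2, 1)]"
  unfolding greedy_questions_iff[OF borel_h pos_h(2)] answer_entropy_h11_balanced
  by (intro conjI ballI answer_entropy_le_log_3 pos_h) simp_all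

section \<open>Comparison of the greedy and dyadic policies\<close>

lemma borel_dyadic_question: "dyadic_question n \<in> sets borel"
  unfolding dyadic_question_def by auto

lemma next_entropy_balanced_less:
  "next_entropy M 2 \<theta> [(Q1, 1), (Q2, 1)] (Q3 \<alpha>' \<beta>') < next_entropy M 2 \<theta> [(Q1, 1), (Q2, 1)] (dyadic_question 3)"
proof -
  have "Q3 \<alpha>' \<beta>' \<in> sets borel" by simp
  then show ?thesis
    using log_2_3_gt
    by (simp only: next_entropy_eq[OF borel_h pos_h(2)] borel_dyadic_question
        answer_entropy_h11_balanced answer_entropy_h11_dyadic)
qed

lemma next_entropy_greedy_le:
  assumes "A \<in> greedy_questions M 2 \<theta> h" "B \<in> sets borel"
  shows "next_entropy M 2 \<theta> h A \<le> next_entropy M 2 \<theta> h B"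
  using assms by (auto simp: greedy_questions_def is_arg_min_def not_less)

text \<open>With the same first two questions, both policies reach the same histories with the same
  probabilities, so the expected entropies are compared term by term through
  \<open>next_entropy\<close>. The greedy term is never larger, and it is strictly smaller at
  answers (1, 1), which have probability 1/4.\<close>

lemma greedy_policy_less_dyadic:
  fixes S :: "'s measure"
  assumes greedy: "greedy_policy M 2 \<theta> S \<pi>"
    and first: "\<And>s. s \<in> space S \<Longrightarrow> \<pi> s [] = Q1 \<and> (\<forall>x. \<pi> s [x] = Q2)"
  shows "s \<in> space S \<Longrightarrow> next_entropy M 2 \<theta> [(Q1, 1), (Q2, 1)] (\<pi> s [1, 1])
      < next_entropy M 2 \<theta> [(Q1, 1), (Q2, 1)] (dyadic_policy s [1, 1])"
    and "expected_entropy M 2 \<theta> S \<pi> 3 < expected_entropy M 2 \<theta> S dyadic_policy 3"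
proof -
  interpret S: prob_space S
    using greedy by (simp add: greedy_policy_def is_policy_def)
  let ?L = "{xs. set xs \<subseteq> {..2::nat} \<and> length xs = 2}"
  let ?H = "\<lambda>xs. [(Q1, xs ! 0), (Q2, xs ! 1)]"
  let ?D = "dyadic_question 3"
  let ?P = "\<lambda>xs. prob (history_event (?H xs))"
  let ?V = "\<lambda>s. \<Sum>xs\<in>?L. ?P xs * next_entropy M 2 \<theta> (?H xs) (\<pi> s xs)"
  let ?W = "\<Sum>xs\<in>?L. ?P xs * next_entropy M 2 \<theta> (?H xs) ?D"
  have L: "finite ?L" by (rule finite_lists_length_eq) simp
  have borel: "\<pi> s xs \<in> sets borel" if "s \<in> space S" for s xs
    using greedy that by (intro policy_borel) (simp_all add: greedy_policy_def)
  have hist: "history_of (\<pi> s) xs = ?H xs" if "s \<in> space S" "length xs = 2" for s xs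
    using first[OF that(1)] that(2) by (auto simp: history_of_def upt_rec take_Suc_conv_app_nth)
  have dyadic_hist: "history_of (dyadic_policy t) xs = ?H xs" if "length xs = 2" for t :: 's and xs
    using that by (auto simp: history_of_def upt_rec dyadic_policy_def dyadic_question_1[unfolded One_nat_def]
        dyadic_question_2 numeral_2_eq_2[symmetric])
  have arg_min: "\<pi> s xs \<in> greedy_questions M 2 \<theta> (?H xs)"
    if "s \<in> space S" "length xs = 2" "0 < ?P xs" for s xs
  proof -
    have "0 < prob (history_event (history_of (\<pi> s) xs)) \<longrightarrow>
        \<pi> s xs \<in> greedy_questions M 2 \<theta> (history_of (\<pi> s) xs)"
      unfolding history_event_history_of using greedy that(1) unfolding greedy_policy_def by blast
    then show ?thesis
      using that(3) unfolding hist[OF that(1,2)] by blast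
  qed
  \<comment> \<open>Different seeds may pick different minimisers, but their values bound each
    other. On null histories, where the greedy condition is silent, the factor \<open>?P xs\<close>
    vanishes.\<close>
  have const: "?P xs * next_entropy M 2 \<theta> (?H xs) (\<pi> s xs) = ?P xs * next_entropy M 2 \<theta> (?H xs) (\<pi> t xs)"
    if "s \<in> space S" "t \<in> space S" "length xs = 2" for s t xs
  proof (cases "0 < ?P xs")
    case True
    have "next_entropy M 2 \<theta> (?H xs) (\<pi> s xs) = next_entropy M 2 \<theta> (?H xs) (\<pi> t xs)"
      by (rule antisym; intro next_entropy_greedy_le arg_min borel that True)
    then show ?thesis by (simp only:)
  qed (simp add: zero_less_measure_iff)
  have le: "?P xs * next_entropy M 2 \<theta> (?H xs) (\<pi> s xs) \<le> ?P xs * next_entropy M 2 \<theta> (?H xs) ?D"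
    if "s \<in> space S" "length xs = 2" for s xs
  proof (cases "0 < ?P xs")
    case True
    then show ?thesis
      using that by (intro mult_left_mono next_entropy_greedy_le arg_min borel_dyadic_question) simp_all
  qed (simp add: zero_less_measure_iff)
  have H11: "?H [1, 1] = [(Q1, 1), (Q2, 1::nat)]" by simp
  have less: "next_entropy M 2 \<theta> [(Q1, 1), (Q2, 1)] (\<pi> s [1, 1]) < next_entropy M 2 \<theta> [(Q1, 1), (Q2, 1)] ?D"
    if "s \<in> space S" for s
  proof -
    have "0 < ?P [1, 1]" unfolding H11 by (rule pos_h)
    from arg_min[OF that _ this] have "\<pi> s [1, 1] \<in> greedy_questions M 2 \<theta> [(Q1, 1), (Q2, 1)]"
      unfolding H11 by simp
    \<comment> \<open>The balanced question serves as a competitor: any greedy choice does at least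
      as well, and the balanced one already beats the dyadic question.\<close>
    then have "next_entropy M 2 \<theta> [(Q1, 1), (Q2, 1)] (\<pi> s [1, 1])
        \<le> next_entropy M 2 \<theta> [(Q1, 1), (Q2, 1)] (Q3 \<alpha>' \<beta>')"
      by (rule next_entropy_greedy_le) simp
    then show ?thesis
      using next_entropy_balanced_less by (rule le_less_trans)
  qed
  then show "next_entropy M 2 \<theta> [(Q1, 1), (Q2, 1)] (\<pi> s [1, 1])
      < next_entropy M 2 \<theta> [(Q1, 1), (Q2, 1)] (dyadic_policy s [1, 1])" if "s \<in> space S" for s
    using that by (simp add: dyadic_policy_def numeral_3_eq_3)
  have three: "Suc 2 = 3" by simp
  \<comment> \<open>A reference seed, at which the seed-independent terms are evaluated.\<close>
  obtain t where t: "t \<in> space S"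
    using S.not_empty by blast
  have inner: "expectation (\<lambda>\<omega>. posterior_entropy M 2 \<theta> (history_of (\<pi> s) (answers 2 \<theta> (\<pi> s) 3 \<omega>))) = ?V t"
    if "s \<in> space S" for s
    unfolding expectation_posterior_entropy_Suc[of "\<pi> s" 2, OF borel[OF that], unfolded three]
  proof (rule sum.cong)
    fix xs assume "xs \<in> ?L"
    then show "prob (history_event (history_of (\<pi> s) xs)) * next_entropy M 2 \<theta> (history_of (\<pi> s) xs) (\<pi> s xs) =
        ?P xs * next_entropy M 2 \<theta> (?H xs) (\<pi> t xs)"
      using const[OF that t, of xs] hist[OF that, of xs] by (simp only: mem_Collect_eq)
  qed simp
  have inner_dyadic: "expectation (\<lambda>\<omega>. posterior_entropy M 2 \<theta> (history_of (dyadic_policy s) (answers 2 \<theta> (dyadic_policy s) 3 \<omega>))) = ?W"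
    for s :: 's
  proof -
    have borel': "dyadic_policy s xs \<in> sets borel" for xs
      by (simp add: dyadic_policy_def borel_dyadic_question)
    show ?thesis
      unfolding expectation_posterior_entropy_Suc[of "dyadic_policy s" 2, OF borel', unfolded three]
    proof (rule sum.cong)
      fix xs assume "xs \<in> ?L"
      moreover from this have "dyadic_policy s xs = ?D"
        by (simp add: dyadic_policy_def)
      ultimately show "prob (history_event (history_of (dyadic_policy s) xs)) *
          next_entropy M 2 \<theta> (history_of (dyadic_policy s) xs) (dyadic_policy s xs) =
          ?P xs * next_entropy M 2 \<theta> (?H xs) ?D"
        using dyadic_hist[of xs s] by (simp only: mem_Collect_eq)
    qed simp
  qed
  have "?V t < ?W"
  \<comment> \<open>One strict term suffices, namely \<open>[1, 1]\<close>: its positive weight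
    preserves the strict inequality between the one-step values.\<close>
  proof (rule sum_strict_mono_ex1[OF L])
    show "\<forall>xs\<in>?L. ?P xs * next_entropy M 2 \<theta> (?H xs) (\<pi> t xs) \<le> ?P xs * next_entropy M 2 \<theta> (?H xs) ?D"
      using le[OF t] by blast
    have "?P [1, 1] * next_entropy M 2 \<theta> (?H [1, 1]) (\<pi> t [1, 1]) < ?P [1, 1] * next_entropy M 2 \<theta> (?H [1, 1]) ?D"
      unfolding H11 by (intro mult_strict_left_mono less t pos_h)
    moreover have "[1, 1] \<in> ?L" by simp
    ultimately show "\<exists>xs\<in>?L. ?P xs * next_entropy M 2 \<theta> (?H xs) (\<pi> t xs) < ?P xs * next_entropy M 2 \<theta> (?H xs) ?D"
      by (rule bexI)
  qed
  moreover have "expected_entropy M 2 \<theta> S \<pi> 3 = ?V t"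
    unfolding expected_entropy_def by (rule S.integral_eq_const[OF inner])
  moreover have "expected_entropy M 2 \<theta> S dyadic_policy 3 = ?W"
    unfolding expected_entropy_def by (rule S.integral_eq_const[OF inner_dyadic])
  ultimately show "expected_entropy M 2 \<theta> S \<pi> 3 < expected_entropy M 2 \<theta> S dyadic_policy 3"
    by (simp only:)
qed

end

theorem mainTheorem7:
  fixes M :: "'w measure" and \<theta> :: "nat \<Rightarrow> 'w \<Rightarrow> real"
    and A1 A2 :: "real set" and A3 :: "real \<Rightarrow> real \<Rightarrow> real set"
    and h02 h11 :: history and \<alpha>' \<beta>' :: real
  assumes "prob_space M"
    and "prob_space.indep_vars M (\<lambda>_. borel) \<theta> {..<2}"
    and "\<And>i. i < 2 \<Longrightarrow> distributed M lborel (\<theta> i) (indicator {0<..1})"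
  defines "A1 \<equiv> {1/2<..1}"
    and "A2 \<equiv> {1/4<..1/2} \<union> {3/4<..1}"
    and "A3 \<equiv> \<lambda>\<alpha> \<beta>. {(1 - \<alpha>)/4<..1/4} \<union> {(2 - \<beta>)/4<..1/2} \<union> {(3 - \<beta>)/4<..3/4} \<union> {(4 - \<alpha>)/4<..1}"
    and "h02 \<equiv> [(A1, 0), (A2, 2)]"
    and "h11 \<equiv> [(A1, 1), (A2, 1)]"
    and "\<alpha>' \<equiv> (1 + sqrt 3 / 3) / 2"
    and "\<beta>' \<equiv> (1 - sqrt 3 / 3) / 2"
  shows
    "(A1 = dyadic_question 1 \<and> A2 = dyadic_question 2 \<and> A3 (1/2) (1/2) = dyadic_question 3) \<and>
     (\<forall>\<alpha>\<in>{0..1}. \<forall>\<beta>\<in>{0..1}. \<forall>x.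
         answer_prob M 2 \<theta> h02 (A3 \<alpha> \<beta>) x = pmf (poisson_binomial_pmf [\<beta>, \<beta>]) x \<and>
         answer_prob M 2 \<theta> h02 (A3 \<alpha> \<beta>) x = pmf (binomial_pmf 2 \<beta>) x) \<and>
     (\<forall>\<alpha>\<in>{0..1}. \<forall>\<beta>\<in>{0..1}. \<forall>\<alpha>\<^sub>0\<in>{0..1}.
         answer_entropy M 2 \<theta> h02 (A3 \<alpha> \<beta>) \<le> answer_entropy M 2 \<theta> h02 (A3 \<alpha>\<^sub>0 (1/2))) \<and>
     (dyadic_question 3 \<in> greedy_questions M 2 \<theta> h02) \<and>
     (\<forall>\<alpha>\<in>{0..1}. \<forall>\<beta>\<in>{0..1}. \<forall>x.
         answer_prob M 2 \<theta> h11 (A3 \<alpha> \<beta>) x =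
           1/4 * pmf (poisson_binomial_pmf [\<alpha>, \<alpha>]) x + 1/4 * pmf (poisson_binomial_pmf [\<beta>, \<beta>]) x +
           1/4 * pmf (poisson_binomial_pmf [\<beta>, \<beta>]) x + 1/4 * pmf (poisson_binomial_pmf [\<alpha>, \<alpha>]) x) \<and>
     (\<forall>\<alpha>\<in>{0..1}. \<forall>\<beta>\<in>{0..1}.
         answer_prob M 2 \<theta> h11 (A3 \<alpha> \<beta>) 0 = 1/2 * (1 - \<alpha>)\<^sup>2 + 1/2 * (1 - \<beta>)\<^sup>2 \<and>
         answer_prob M 2 \<theta> h11 (A3 \<alpha> \<beta>) 1 = \<alpha> * (1 - \<alpha>) + \<beta> * (1 - \<beta>) \<and>
         answer_prob M 2 \<theta> h11 (A3 \<alpha> \<beta>) 2 = 1/2 * \<alpha>\<^sup>2 + 1/2 * \<beta>\<^sup>2) \<and>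
     (\<forall>x\<in>{0, 1, 2}. answer_prob M 2 \<theta> h11 (A3 \<alpha>' \<beta>') x = 1/3) \<and>
     (answer_entropy M 2 \<theta> h11 (A3 \<alpha>' \<beta>') = log 2 3) \<and>
     (log 2 3 > (1.5 :: real)) \<and>
     (answer_entropy M 2 \<theta> h11 (dyadic_question 3) = 1.5) \<and>
     (A3 \<alpha>' \<beta>' \<in> greedy_questions M 2 \<theta> h11) \<and>
     (next_entropy M 2 \<theta> h11 (A3 \<alpha>' \<beta>') < next_entropy M 2 \<theta> h11 (dyadic_question 3)) \<and>
     (\<forall>(S :: 's measure) \<pi>. greedy_policy M 2 \<theta> S \<pi> \<and>
           (\<forall>s\<in>space S. \<pi> s [] = A1 \<and> (\<forall>x. \<pi> s [x] = A2)) \<longrightarrow>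
         (\<forall>s\<in>space S. next_entropy M 2 \<theta> h11 (\<pi> s [1, 1])
                        < next_entropy M 2 \<theta> h11 (dyadic_policy s [1, 1])) \<and>
         expected_entropy M 2 \<theta> S \<pi> 3 < expected_entropy M 2 \<theta> S dyadic_policy 3)"
proof -
  interpret two_uniform_objects M \<theta>
    using assms(1-3) by (auto simp: two_uniform_objects_def uniform_objects_def uniform_objects_axioms_def)
  note defs = A1_def A2_def A3_def h02_def h11_def \<alpha>'_def \<beta>'_def
  show ?thesis
    unfolding defs
  proof (intro conjI ballI allI impI)
    fix \<alpha> \<beta> :: real and x :: nat
    assume ab: "\<alpha> \<in> {0..1}" "\<beta> \<in> {0..1}"
    show "answer_prob M 2 \<theta> [(Q1, 0), (Q2, 2)] (Q3 \<alpha> \<beta>) x = pmf (poisson_binomial_pmf [\<beta>, \<beta>]) x"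
      by (rule answer_prob_h02_Q3[OF ab])
    show "answer_prob M 2 \<theta> [(Q1, 0), (Q2, 2)] (Q3 \<alpha> \<beta>) x = pmf (binomial_pmf 2 \<beta>) x"
      unfolding answer_prob_h02_Q3[OF ab] pmf_binomial_2[OF ab(2)] ..
    show "answer_prob M 2 \<theta> [(Q1, 1), (Q2, 1)] (Q3 \<alpha> \<beta>) x =
        1/4 * pmf (poisson_binomial_pmf [\<alpha>, \<alpha>]) x + 1/4 * pmf (poisson_binomial_pmf [\<beta>, \<beta>]) x +
        1/4 * pmf (poisson_binomial_pmf [\<beta>, \<beta>]) x + 1/4 * pmf (poisson_binomial_pmf [\<alpha>, \<alpha>]) x"
      by (rule answer_prob_h11_Q3[OF ab])
    show "answer_prob M 2 \<theta> [(Q1, 1), (Q2, 1)] (Q3 \<alpha> \<beta>) 0 = 1/2 * (1 - \<alpha>)\<^sup>2 + 1/2 * (1 - \<beta>)\<^sup>2"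
      "answer_prob M 2 \<theta> [(Q1, 1), (Q2, 1)] (Q3 \<alpha> \<beta>) 1 = \<alpha> * (1 - \<alpha>) + \<beta> * (1 - \<beta>)"
      "answer_prob M 2 \<theta> [(Q1, 1), (Q2, 1)] (Q3 \<alpha> \<beta>) 2 = 1/2 * \<alpha>\<^sup>2 + 1/2 * \<beta>\<^sup>2"
      by (rule answer_prob_h11_Q3_values[OF ab])+
  next
    fix \<alpha> \<beta> \<alpha>\<^sub>0 :: real
    assume "\<alpha>\<^sub>0 \<in> {0..1}"
    then show "answer_entropy M 2 \<theta> [(Q1, 0), (Q2, 2)] (Q3 \<alpha> \<beta>)
        \<le> answer_entropy M 2 \<theta> [(Q1, 0), (Q2, 2)] (Q3 \<alpha>\<^sub>0 (1/2))"
      by (simp only: answer_entropy_h02_half) (rule answer_entropy_h02_le, simp)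
  next
    fix S :: "'s measure" and \<pi>
    assume "greedy_policy M 2 \<theta> S \<pi> \<and> (\<forall>s\<in>space S. \<pi> s [] = Q1 \<and> (\<forall>x. \<pi> s [x] = Q2))"
    then have greedy: "greedy_policy M 2 \<theta> S \<pi>"
      and first: "\<And>s. s \<in> space S \<Longrightarrow> \<pi> s [] = Q1 \<and> (\<forall>x. \<pi> s [x] = Q2)"
      by blast+
    show "expected_entropy M 2 \<theta> S \<pi> 3 < expected_entropy M 2 \<theta> S dyadic_policy 3"
      using greedy first by (rule greedy_policy_less_dyadic(2))
    fix s assume "s \<in> space S"
    with greedy first show "next_entropy M 2 \<theta> [(Q1, 1), (Q2, 1)] (\<pi> s [1, 1])
        < next_entropy M 2 \<theta> [(Q1, 1), (Q2, 1)] (dyadic_policy s [1, 1])"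
      by (rule greedy_policy_less_dyadic(1))
  qed (fact dyadic_question_1[symmetric] dyadic_question_2[symmetric] dyadic_question_3[symmetric]
      dyadic_greedy_h02 answer_prob_h11_balanced answer_entropy_h11_balanced log_2_3_gt
      answer_entropy_h11_dyadic balanced_greedy_h11 next_entropy_balanced_less)+
qed

end
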